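(* The asymptotic growth constant for the number of dimer-monomers on the four-dimensional Sierpinski gasket $SG_4(n)$, $$z_{SG_4}=\lim_{n\to\infty}\frac{\ln N_{DM}(SG_4(n))}{v(SG_4(n))},$$ is $z_{SG_4}=0.876779402949\ldots$ (i.e. its decimal expansion begins with the digits shown).
   Context: A dimer-monomer configuration on a finite graph $G$ is a placement of dimers on edges such that each vertex is covered by at most one dimer (i.e. a matching of $G$, not necessarily perfect, possibly empty). $N_{DM}(G)$ is the number of such configurations, and $v(G)$ is the number of vertices of $G$. The $d$-dimensional Sierpinski gasket graph $SG_d(n)$, with $d+1$ distinguished "outmost" vertices labelled $1,\dots,d+1$, is defined recursively. $SG_d(0)$ is the complete graph on $d+1$ vertices, all of which are outmost. $SG_d(n+1)$ is obtained from $d+1$ disjoint copies of $SG_d(n)$, labelled $1,\dots,d+1$, by identifying, for each pair $l\neq m$, the outmost vertex $m$ of copy $l$ with the outmost vertex $l$ of copy $m$; the outmost vertex $l$ of $SG_d(n+1)$ is the outmost vertex $l$ of copy $l$. One has $v(SG_d(n))=\frac{d+1}{2}[(d+1)^n+1]$. Here $d=4$. *)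

theory Defs
  imports Complex_Main
begin

type_synonym 'a graph = "'a set \<times> 'a set set"

abbreviation verts :: "'a graph \<Rightarrow> 'a set" where
  "verts G \<equiv> fst G"

abbreviation edges :: "'a graph \<Rightarrow> 'a set set" where
  "edges G \<equiv> snd G"

definition complete_graph :: "'a set \<Rightarrow> 'a graph" where
  "complete_graph V = (V, {{u, v} | u v. u \<in> V \<and> v \<in> V \<and> u \<noteq> v})"

definition dimer_monomers :: "'a graph \<Rightarrow> 'a set set set" where
  "dimer_monomers G =
     {M. M \<subseteq> edges G \<and> (\<forall>v\<in>verts G. \<forall>e\<in>M. \<forall>f\<in>M. v \<in> e \<and> v \<in> f \<longrightarrow> e = f)}"

definition N_DM :: "'a graph \<Rightarrow> nat" where
  "N_DM G = card (dimer_monomers G)"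

text \<open>
  A vertex of the gasket of level \<open>n\<close> is a word of length \<open>n + 1\<close> over the labels
  \<open>1, \<dots>, d + 1\<close>: the vertex \<open>x\<close> of the copy labelled \<open>l\<close> of the gasket of level \<open>n\<close>
  is written \<open>l # x\<close>. Of the two words that name an identified vertex of level \<open>n + 1\<close>
  (vertex \<open>m\<close> of copy \<open>l\<close>, vertex \<open>l\<close> of copy \<open>m\<close>), the one with the smaller leading
  label is kept.
\<close>

primrec outmost :: "nat \<Rightarrow> nat \<Rightarrow> nat list" where
  "outmost 0 l = [l]"
| "outmost (Suc n) l = l # outmost n l"

text \<open>
  \<open>glue n l\<close> sends a vertex of copy \<open>l\<close> of the gasket of level \<open>n\<close> to the vertex of the
  gasket of level \<open>n + 1\<close> that it becomes; \<open>x\<close> is the outmost vertex \<open>m\<close> iff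
  \<open>x = outmost n m\<close>, and then \<open>m = hd x\<close>.
\<close>

definition glue :: "nat \<Rightarrow> nat \<Rightarrow> nat list \<Rightarrow> nat list" where
  "glue n l x =
     (if hd x < l \<and> x = outmost n (hd x) then hd x # outmost n l else l # x)"

primrec SG :: "nat \<Rightarrow> nat \<Rightarrow> nat list graph" where
  "SG d 0 = complete_graph (outmost 0 ` {1..d + 1})"
| "SG d (Suc n) =
     (\<Union>l\<in>{1..d + 1}. glue n l ` verts (SG d n),
      \<Union>l\<in>{1..d + 1}. (\<lambda>e. glue n l ` e) ` edges (SG d n))"

lemma hd_outmost [simp]: "hd (outmost n l) = l"
  by (cases n) auto

lemma outmost_eq_iff [simp]: "outmost n l = outmost n m \<longleftrightarrow> l = m"
  by (metis hd_outmost)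

text \<open>
  The identifications made by \<open>glue\<close> are exactly the prescribed ones, and the outmost
  vertex \<open>l\<close> of copy \<open>l\<close> becomes the outmost vertex \<open>l\<close> of the next level.
\<close>

lemma glue_eq_iff:
  "glue n l x = glue n m y \<longleftrightarrow>
     (l = m \<and> x = y) \<or> (l \<noteq> m \<and> x = outmost n m \<and> y = outmost n l)"
  unfolding glue_def by (auto split: if_splits)

lemma glue_outmost: "glue n l (outmost n l) = outmost (Suc n) l"
  by (simp add: glue_def)

lemma outmost_in_SG: "l \<in> {1..d + 1} \<Longrightarrow> outmost n l \<in> verts (SG d n)"
proof (induction n)
  case 0
  then show ?case by (simp add: complete_graph_def)
next
  case (Suc n)
  then have "glue n l (outmost n l) \<in> verts (SG d (Suc n))" by fastforce
  then show ?case by (simp only: glue_outmost)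
qed

end

theory Submission
  imports Defs
    "HOL-Library.FuncSet"
    "HOL-Library.Disjoint_Sets"
    "HOL-Computational_Algebra.Polynomial"
    "HOL-Analysis.Harmonic_Numbers"
begin

text \<open>
  Let \<open>f\<^sub>n(k)\<close> be the number of dimer-monomers of the gasket of level \<open>n\<close> that cover exactly \<open>k\<close>
  prescribed outmost vertices. A dimer-monomer of level \<open>n + 1\<close> is a choice, at each of the
  junctions between two copies, of at most one copy covering it, together with a dimer-monomer of
  each copy with the boundary this prescribes; so \<open>f\<^sub>n\<^sub>+\<^sub>1\<close> is a homogeneous polynomial of degree
  \<open>d + 1\<close> in \<open>f\<^sub>n\<close> with nonnegative coefficients. If all ratios \<open>f\<^sub>n(k + 1) / f\<^sub>n(k)\<close> lie in \<open>[a, b]\<close>,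
  comparing summands shows that the ratios at level \<open>n + 1\<close> do so too and that
  \<open>f\<^sub>n\<^sub>+\<^sub>1(0) / f\<^sub>n(0)^(d + 1)\<close> lies between the powers of \<open>1 + 2a\<close> and \<open>1 + 2b\<close> with exponent the
  number of junctions. Hence level \<open>m\<close> determines the growth constant up to
  \<open>(ln (1 + 2b) - ln (1 + 2a)) / (d + 1)^m\<close>. The ratios converge doubly exponentially, and for \<open>d = 4\<close>
  level \<open>4\<close> suffices.
\<close>

subsection \<open>Dimer-monomers with prescribed boundary\<close>

text \<open>Geometric counts are the model case. If \<open>f k = C * a ^ k\<close>, a junction
  choice is weighted only by the number of covered junctions, so the junctions decouple and each
  contributes \<open>1 + 2 * a\<close>: left free, or covered from one of its two sides. The step
  maps such a sequence to one with the same ratio. Near it, a small relative perturbation of the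
  counts changes the logarithm of the image, to first order, by a term affine in \<open>k\<close>,
  which is again a geometric correction; deviations from geometric therefore get squared at each
  level. This heuristic explains why level four is enough; the proof itself only verifies an
  interval of ratios there. The obstacle is evaluation. For \<open>d = 4\<close> the ten junctions
  admit \<open>3 ^ 10\<close> choices, so the sum is never enumerated: copies are eliminated one at
  a time and equal terms merged by symmetry, and one evaluation over polynomials yields all six
  counts of a level. Counts at level three have about 118 digits. Level four is only bounded, by
  applying the step to their leading 16 or 17 digits; this works because the step is monotone and
  homogeneous of degree five.\<close>

lemma edges_SG:
  "e \<in> edges (SG d n) \<Longrightarrow> e \<subseteq> verts (SG d n) \<and> card e = 2"
proof (induction n arbitrary: e)
  case 0
  then show ?case by (auto simp: complete_graph_def)
next
  case (Suc n)
  then obtain l e' where l: "l \<in> {1..d+1}" and e': "e' \<in> edges (SG d n)" and e: "e = glue n l ` e'"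
    by auto
  have "inj_on (glue n l) e'" by (auto simp: inj_on_def glue_eq_iff)
  then have "card e = 2" using Suc.IH[OF e'] e by (simp add: card_image)
  moreover have "e \<subseteq> verts (SG d (Suc n))" using Suc.IH[OF e'] l unfolding e SG.simps fst_conv by blast
  ultimately show ?case by blast
qed

lemma finite_verts_SG: "finite (verts (SG d n))"
  by (induction n) (auto simp: complete_graph_def)

lemma finite_edges_SG: "finite (edges (SG d n))"
  by (rule finite_subset[of _ "Pow (verts (SG d n))"]) (auto simp: finite_verts_SG dest: edges_SG)

lemma dimer_monomers_SG_iff:
  "M \<in> dimer_monomers (SG d n) \<longleftrightarrow>
     M \<subseteq> edges (SG d n) \<and> (\<forall>e\<in>M. \<forall>f\<in>M. \<forall>v. v \<in> e \<longrightarrow> v \<in> f \<longrightarrow> e = f)"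
proof -
  have "v \<in> verts (SG d n)" if "v \<in> e" "e \<in> edges (SG d n)" for v e
    using edges_SG[OF that(2)] that(1) by blast
  then show ?thesis unfolding dimer_monomers_def mem_Collect_eq by (meson subsetD)
qed

lemma finite_dimer_monomers_SG: "finite (dimer_monomers (SG d n))"
  by (rule finite_subset[of _ "Pow (edges (SG d n))"])
     (auto simp: finite_edges_SG dimer_monomers_SG_iff)

definition covered :: "nat \<Rightarrow> nat \<Rightarrow> nat list set set \<Rightarrow> nat set" where
  "covered d n M = {l \<in> {1..d+1}. outmost n l \<in> \<Union>M}"

text \<open>Coverage is prescribed exactly, since whether a shared vertex is free decides what the
  neighbouring copy may do there.\<close>

definition cnt :: "nat \<Rightarrow> nat \<Rightarrow> nat set \<Rightarrow> nat" where
  "cnt d n S = card {M \<in> dimer_monomers (SG d n). covered d n M = S}"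

lemma covered_subset: "covered d n M \<subseteq> {1..d+1}"
  by (auto simp: covered_def)

lemma N_DM_eq_sum_cnt: "N_DM (SG d n) = (\<Sum>S\<in>Pow {1..d+1}. cnt d n S)"
proof -
  have "dimer_monomers (SG d n) = (\<Union>S\<in>Pow {1..d+1}. {M \<in> dimer_monomers (SG d n). covered d n M = S})"
    using covered_subset by blast
  then have "N_DM (SG d n) = card (\<Union>S\<in>Pow {1..d+1}. {M \<in> dimer_monomers (SG d n). covered d n M = S})"
    unfolding N_DM_def by (rule arg_cong)
  also have "\<dots> = (\<Sum>S\<in>Pow {1..d+1}. cnt d n S)"
    unfolding cnt_def by (rule card_UN_disjoint) (auto simp: finite_dimer_monomers_SG)
  finally show ?thesis .
qed

text \<open>
  \<open>B l\<close> is the set of labels \<open>m\<close> such that copy \<open>l\<close> covers the vertex it shares with copy \<open>m\<close>;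
  at most one of the two copies may do so.
\<close>

definition junction_choices :: "'l set \<Rightarrow> ('l \<Rightarrow> 'l set) set" where
  "junction_choices L = {B \<in> (\<Pi>\<^sub>E l\<in>L. Pow (L - {l})). \<forall>l\<in>L. \<forall>m\<in>B l. l \<notin> B m}"

lemma finite_junction_choices: "finite L \<Longrightarrow> finite (junction_choices L)"
  unfolding junction_choices_def
  by (rule finite_subset[of _ "\<Pi>\<^sub>E l\<in>L. Pow (L - {l})"]) (auto intro!: finite_PiE)

text \<open>Two different copies have only one vertex in common, while an edge has two, so every
  edge of the next level comes from exactly one copy.\<close>

lemma glue_image_eq_iff:
  assumes "e \<in> edges (SG d n)" "f \<in> edges (SG d n)"
  shows "glue n l ` e = glue n m ` f \<longleftrightarrow> l = m \<and> e = f"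
proof
  assume eq: "glue n l ` e = glue n m ` f"
  have inj: "inj (glue n l)" by (auto simp: inj_def glue_eq_iff)
  have "l = m"
  proof (rule ccontr)
    assume "l \<noteq> m"
    have "e \<subseteq> {outmost n m}"
    proof
      fix x assume "x \<in> e"
      then have "glue n l x \<in> glue n m ` f" using eq by blast
      then show "x \<in> {outmost n m}" using \<open>l \<noteq> m\<close> by (auto simp: glue_eq_iff)
    qed
    then have "card e \<le> 1" using card_mono[of "{outmost n m}" e] by simp
    then show False using edges_SG[OF assms(1)] by simp
  qed
  then show "l = m \<and> e = f" using eq inj by (simp add: inj_image_eq_iff)
qed auto

text \<open>Restriction to the copies is inverted by gluing because the copies have no common edge.
  Dimers of different copies can only collide at a shared vertex, and they do so exactly when both
  copies cover it; hence the pairwise condition on \<open>covered\<close>.\<close>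

lemma bij_betw_dimer_monomers_Suc:
  fixes d n :: nat
  defines "L \<equiv> {1..d+1}"
  defines "part \<equiv> \<lambda>M. \<lambda>l\<in>L. {e \<in> edges (SG d n). glue n l ` e \<in> M}"
  assumes S: "S \<subseteq> L"
  shows "bij_betw part {M \<in> dimer_monomers (SG d (Suc n)). covered d (Suc n) M = S}
     {Ms \<in> \<Pi>\<^sub>E l\<in>L. dimer_monomers (SG d n).
        (\<forall>l\<in>L. \<forall>m\<in>L. l \<noteq> m \<longrightarrow> m \<in> covered d n (Ms l) \<longrightarrow> l \<notin> covered d n (Ms m)) \<and>
        (\<forall>l\<in>L. l \<in> covered d n (Ms l) \<longleftrightarrow> l \<in> S)}"
    (is "bij_betw part ?A ?B")
proof -
  let ?E = "edges (SG d n)"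
  define join where "join Ms = (\<Union>l\<in>L. (\<lambda>e. glue n l ` e) ` Ms l)" for Ms :: "nat \<Rightarrow> nat list set set"
  have E_Suc: "edges (SG d (Suc n)) = (\<Union>l\<in>L. (\<lambda>e. glue n l ` e) ` ?E)"
    by (simp add: L_def)
  have inj: "inj (glue n l)" for l by (auto simp: inj_def glue_eq_iff)
  have shared: "glue n l (outmost n m) = glue n m (outmost n l)" for l m
    by (auto simp: glue_eq_iff)
  show ?thesis
  proof (rule bij_betw_byWitness[where f' = join])
    show "\<forall>M\<in>?A. join (part M) = M"
    proof
      fix M assume "M \<in> ?A"
      then have "M \<subseteq> edges (SG d (Suc n))" by (simp only: dimer_monomers_SG_iff mem_Collect_eq)
      then have sub: "M \<subseteq> (\<Union>l\<in>L. (\<lambda>e. glue n l ` e) ` ?E)" unfolding E_Suc .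
      have eq: "join (part M) = (\<Union>l\<in>L. (\<lambda>e. glue n l ` e) ` {e \<in> ?E. glue n l ` e \<in> M})"
        by (simp add: join_def part_def)
      show "join (part M) = M" unfolding eq
      proof (rule equalityI)
        show "(\<Union>l\<in>L. (\<lambda>e. glue n l ` e) ` {e \<in> ?E. glue n l ` e \<in> M}) \<subseteq> M"
          by (intro UN_least image_subsetI) simp
        show "M \<subseteq> (\<Union>l\<in>L. (\<lambda>e. glue n l ` e) ` {e \<in> ?E. glue n l ` e \<in> M})"
        proof
          fix x assume x: "x \<in> M"
          then obtain l e where "l \<in> L" "e \<in> ?E" "x = glue n l ` e" using sub by blast
          then show "x \<in> (\<Union>l\<in>L. (\<lambda>e. glue n l ` e) ` {e \<in> ?E. glue n l ` e \<in> M})"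
            using x by (intro UN_I[of l] image_eqI[of _ _ e]) simp_all
        qed
      qed
    qed
    show "\<forall>Ms\<in>?B. part (join Ms) = Ms"
    proof
      fix Ms assume Ms: "Ms \<in> ?B"
      have sub: "Ms l \<subseteq> ?E" if "l \<in> L" for l
      proof -
        have "Ms l \<in> dimer_monomers (SG d n)" using Ms that by (simp add: PiE_iff)
        then show ?thesis unfolding dimer_monomers_SG_iff by simp
      qed
      have "part (join Ms) l = Ms l" if "l \<in> L" for l
      proof -
        have "e \<in> part (join Ms) l \<longleftrightarrow> e \<in> Ms l" for e
        proof
          assume "e \<in> part (join Ms) l"
          then have e: "e \<in> ?E" "glue n l ` e \<in> join Ms" using that by (simp_all add: part_def)
          then obtain m f where f: "m \<in> L" "f \<in> Ms m" "glue n l ` e = glue n m ` f"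
            unfolding join_def by blast
          then have "f \<in> ?E" using sub by blast
          then show "e \<in> Ms l" using glue_image_eq_iff[OF e(1)] f by simp
        next
          assume "e \<in> Ms l"
          then show "e \<in> part (join Ms) l" using sub[OF that] that
            unfolding part_def join_def by (simp add: subset_iff) blast
        qed
        then show ?thesis by blast
      qed
      moreover have "part (join Ms) l = Ms l" if "l \<notin> L" for l
        using that Ms by (auto simp: part_def PiE_iff extensional_def)
      ultimately show "part (join Ms) = Ms" by blast
    qed
    show "part ` ?A \<subseteq> ?B"
    proof
      fix Ms assume "Ms \<in> part ` ?A"
      then obtain M where M: "M \<in> dimer_monomers (SG d (Suc n))" and cov: "covered d (Suc n) M = S"
        and Ms: "Ms = part M" by blast
      have disj: "e = f" if "e \<in> M" "f \<in> M" "v \<in> e" "v \<in> f" for e f v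
        using M that unfolding dimer_monomers_SG_iff by blast
      have sub: "M \<subseteq> (\<Union>l\<in>L. (\<lambda>e. glue n l ` e) ` ?E)"
        using M unfolding dimer_monomers_SG_iff E_Suc by blast
      have 1: "Ms l \<in> dimer_monomers (SG d n)" if "l \<in> L" for l
      proof -
        have "e = f" if "e \<in> Ms l" "f \<in> Ms l" "v \<in> e" "v \<in> f" for e f v
        proof -
          have "glue n l ` e = glue n l ` f"
            by (rule disj[where v = "glue n l v"]) (use that \<open>l \<in> L\<close> in \<open>auto simp: Ms part_def\<close>)
          then show ?thesis using inj by (simp add: inj_image_eq_iff)
        qed
        then show ?thesis using that unfolding dimer_monomers_SG_iff by (simp add: Ms part_def)
      qed
      have 2: "l \<notin> covered d n (Ms m)" if lm: "l \<in> L" "m \<in> L" "l \<noteq> m" "m \<in> covered d n (Ms l)" for l m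
      proof
        assume "l \<in> covered d n (Ms m)"
        then obtain f where f: "f \<in> ?E" "glue n m ` f \<in> M" "outmost n l \<in> f"
          using lm by (auto simp: covered_def Ms part_def)
        obtain e where e: "e \<in> ?E" "glue n l ` e \<in> M" "outmost n m \<in> e"
          using lm by (auto simp: covered_def Ms part_def)
        have "glue n l ` e = glue n m ` f"
          by (rule disj[where v = "glue n l (outmost n m)"]) (use e f shared in auto)
        then show False using e f lm glue_image_eq_iff by blast
      qed
      have 3: "l \<in> covered d n (Ms l) \<longleftrightarrow> l \<in> S" if l: "l \<in> L" for l
      proof -
        have "outmost (Suc n) l \<in> \<Union>M \<longleftrightarrow> outmost n l \<in> \<Union>(Ms l)"
        proof
          assume "outmost (Suc n) l \<in> \<Union>M"
          then obtain m e where me: "m \<in> L" "e \<in> ?E" "glue n m ` e \<in> M" "outmost (Suc n) l \<in> glue n m ` e"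
            using sub by blast
          then obtain x where x: "x \<in> e" "glue n m x = glue n l (outmost n l)"
            by (metis glue_outmost imageE)
          \<comment> \<open>Copies \<open>m\<close> and \<open>l\<close> with
            \<open>m \<noteq> l\<close> meet only in the vertex that copy \<open>l\<close> calls
            \<open>outmost n m\<close>, so the corner \<open>outmost n l\<close> of copy
            \<open>l\<close> lies in no other copy.\<close>
          then have "m = l \<and> x = outmost n l" by (auto simp: glue_eq_iff)
          then show "outmost n l \<in> \<Union>(Ms l)" using me x l by (auto simp: Ms part_def)
        next
          assume "outmost n l \<in> \<Union>(Ms l)"
          then show "outmost (Suc n) l \<in> \<Union>M"
            using l unfolding glue_outmost[symmetric] by (auto simp: Ms part_def)
        qed
        then show ?thesis using cov l by (auto simp: covered_def L_def)
      qed
      show "Ms \<in> ?B" using 1 2 3 by (auto simp: Ms part_def)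
    qed
    show "join ` ?B \<subseteq> ?A"
    proof
      fix M assume "M \<in> join ` ?B"
      then obtain Ms where Ms: "Ms \<in> ?B" and M: "M = join Ms" by blast
      have dm: "Ms l \<in> dimer_monomers (SG d n)" if "l \<in> L" for l
        using Ms that by (auto simp: PiE_iff)
      have compat: "\<not> (m \<in> covered d n (Ms l) \<and> l \<in> covered d n (Ms m))"
        if "l \<in> L" "m \<in> L" "l \<noteq> m" for l m
        using Ms that by blast
      have "e = f" if ef: "e \<in> M" "f \<in> M" "v \<in> e" "v \<in> f" for e f v
      proof -
        obtain l e' where e: "l \<in> L" "e' \<in> Ms l" "e = glue n l ` e'"
          using ef unfolding M join_def by blast
        obtain m f' where f: "m \<in> L" "f' \<in> Ms m" "f = glue n m ` f'"
          using ef unfolding M join_def by blast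
        obtain x y where xy: "x \<in> e'" "y \<in> f'" "glue n l x = glue n m y"
          using ef e f by auto
        consider "l = m" "x = y" | "l \<noteq> m" "x = outmost n m" "y = outmost n l"
          using xy by (auto simp: glue_eq_iff)
        then show ?thesis
        proof cases
          case 1
          then have "e' = f'" using dm[OF e(1)] e f xy unfolding dimer_monomers_SG_iff by blast
          then show ?thesis using e f 1 by simp
        next
          case 2
          then have "m \<in> covered d n (Ms l)" "l \<in> covered d n (Ms m)"
            using e f xy by (auto simp: covered_def L_def)
          then show ?thesis using compat e f 2 by blast
        qed
      qed
      moreover have "M \<subseteq> edges (SG d (Suc n))"
        using dm unfolding M join_def E_Suc dimer_monomers_SG_iff by blast
      ultimately have "M \<in> dimer_monomers (SG d (Suc n))"
        unfolding dimer_monomers_SG_iff by blast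
      moreover have "outmost (Suc n) l \<in> \<Union>M \<longleftrightarrow> l \<in> S" if l: "l \<in> L" for l
      proof -
        have "outmost (Suc n) l \<in> \<Union>M \<longleftrightarrow>
            (\<exists>m\<in>L. \<exists>e\<in>Ms m. \<exists>x\<in>e. glue n l (outmost n l) = glue n m x)"
          unfolding M join_def glue_outmost[symmetric] by auto
        also have "\<dots> \<longleftrightarrow> outmost n l \<in> \<Union>(Ms l)" using l by (auto simp: glue_eq_iff)
        also have "\<dots> \<longleftrightarrow> l \<in> covered d n (Ms l)" using l by (auto simp: covered_def L_def)
        also have "\<dots> \<longleftrightarrow> l \<in> S" using Ms l by blast
        finally show ?thesis .
      qed
      then have "covered d (Suc n) M = S" using S unfolding covered_def L_def by blast
      ultimately show "M \<in> ?A" by blast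
    qed
  qed
qed

text \<open>Configurations are sorted by \<open>B l\<close>, the covered labels of copy
  \<open>l\<close> other than \<open>l\<close>. The label \<open>l\<close> itself marks no junction
  but an outmost vertex of the next level, hence is governed by \<open>S\<close>. For fixed
  \<open>B\<close> the copies are independent, which gives the product.\<close>

lemma cnt_Suc:
  assumes S: "S \<subseteq> {1..d+1}"
  shows "cnt d (Suc n) S =
    (\<Sum>B\<in>junction_choices {1..d+1}. \<Prod>l\<in>{1..d+1}. cnt d n (B l \<union> ({l} \<inter> S)))"
proof -
  define L where "L = {1..d+1}"
  define X where "X B = (\<Pi>\<^sub>E l\<in>L. {M \<in> dimer_monomers (SG d n). covered d n M = B l \<union> ({l} \<inter> S)})" for B
  have fin: "finite (X B)" for B
    unfolding X_def by (intro finite_PiE) (auto simp: L_def finite_dimer_monomers_SG)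
  have cov: "covered d n M \<subseteq> L" for M by (auto simp: covered_def L_def)
  have "cnt d (Suc n) S = card {Ms \<in> \<Pi>\<^sub>E l\<in>L. dimer_monomers (SG d n).
        (\<forall>l\<in>L. \<forall>m\<in>L. l \<noteq> m \<longrightarrow> m \<in> covered d n (Ms l) \<longrightarrow> l \<notin> covered d n (Ms m)) \<and>
        (\<forall>l\<in>L. l \<in> covered d n (Ms l) \<longleftrightarrow> l \<in> S)}"
    unfolding cnt_def L_def using bij_betw_dimer_monomers_Suc[OF S] by (rule bij_betw_same_card)
  also have "{Ms \<in> \<Pi>\<^sub>E l\<in>L. dimer_monomers (SG d n).
        (\<forall>l\<in>L. \<forall>m\<in>L. l \<noteq> m \<longrightarrow> m \<in> covered d n (Ms l) \<longrightarrow> l \<notin> covered d n (Ms m)) \<and>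
        (\<forall>l\<in>L. l \<in> covered d n (Ms l) \<longleftrightarrow> l \<in> S)} = (\<Union>B\<in>junction_choices L. X B)" (is "?R = _")
  proof (intro equalityI subsetI)
    fix Ms assume Ms: "Ms \<in> ?R"
    define B where "B = (\<lambda>l\<in>L. covered d n (Ms l) - {l})"
    have "B \<in> junction_choices L"
      using Ms cov unfolding junction_choices_def B_def by (auto simp: subset_iff)
    moreover have "Ms \<in> X B"
      using Ms unfolding X_def B_def by (auto simp: PiE_iff)
    ultimately show "Ms \<in> (\<Union>B\<in>junction_choices L. X B)" by blast
  next
    fix Ms assume "Ms \<in> (\<Union>B\<in>junction_choices L. X B)"
    then obtain B where B: "B \<in> junction_choices L" and Ms: "Ms \<in> X B" by blast
    have Ms1: "covered d n (Ms l) = B l \<union> ({l} \<inter> S)" "Ms l \<in> dimer_monomers (SG d n)" if "l \<in> L" for l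
      using Ms that by (auto simp: X_def PiE_iff)
    have B1: "B l \<subseteq> L - {l}" if "l \<in> L" for l
      using B that by (auto simp: junction_choices_def PiE_iff)
    have B2: "l \<notin> B m" if "l \<in> L" "m \<in> B l" for l m
      using B that by (auto simp: junction_choices_def)
    have "Ms \<in> (\<Pi>\<^sub>E l\<in>L. dimer_monomers (SG d n))"
      using Ms1 Ms by (auto simp: X_def PiE_iff)
    moreover have "l \<notin> covered d n (Ms m)" if "l \<in> L" "m \<in> L" "l \<noteq> m" "m \<in> covered d n (Ms l)" for l m
      using that B2[of l m] by (simp add: Ms1)
    moreover have "l \<in> covered d n (Ms l) \<longleftrightarrow> l \<in> S" if "l \<in> L" for l
      using that B1[of l] by (auto simp: Ms1)
    ultimately show "Ms \<in> ?R" by blast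
  qed
  also have "card (\<Union>B\<in>junction_choices L. X B) = (\<Sum>B\<in>junction_choices L. card (X B))"
  proof (rule card_UN_disjoint)
    show "\<forall>B\<in>junction_choices L. \<forall>B'\<in>junction_choices L. B \<noteq> B' \<longrightarrow> X B \<inter> X B' = {}"
    proof (intro ballI impI, rule ccontr)
      fix B B' assume B: "B \<in> junction_choices L" "B' \<in> junction_choices L" "B \<noteq> B'"
        and "X B \<inter> X B' \<noteq> {}"
      then obtain Ms where Ms: "Ms \<in> X B" "Ms \<in> X B'" by blast
      have "B l = B' l" if "l \<in> L" for l
      proof -
        have "B l \<union> ({l} \<inter> S) = B' l \<union> ({l} \<inter> S)"
          using Ms that by (auto simp: X_def PiE_iff)
        moreover have "l \<notin> B l" "l \<notin> B' l"
          using B that by (auto simp: junction_choices_def PiE_iff)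
        ultimately show ?thesis by blast
      qed
      moreover have "B \<in> extensional L" "B' \<in> extensional L"
        using B by (auto simp: junction_choices_def PiE_iff)
      ultimately have "B = B'" by (intro extensionalityI)
      then show False using B(3) by simp
    qed
  qed (simp_all add: fin finite_junction_choices L_def)
  also have "\<dots> = (\<Sum>B\<in>junction_choices L. \<Prod>l\<in>L. cnt d n (B l \<union> ({l} \<inter> S)))"
    unfolding X_def cnt_def by (simp add: card_PiE L_def)
  finally show ?thesis by (simp add: L_def)
qed

subsection \<open>Sums over junction choices\<close>

text \<open>The weight may differ between copies because eliminating one copy alters the others
  unequally. It sees \<open>B l\<close> only through its cardinality, anticipating that the counts
  are symmetric in the labels.\<close>

definition junction_sum :: "'l set \<Rightarrow> ('l \<Rightarrow> nat \<Rightarrow> 'a) \<Rightarrow> 'a :: comm_semiring_1" where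
  "junction_sum L F = (\<Sum>B\<in>junction_choices L. \<Prod>l\<in>L. F l (card (B l)))"

lemma junction_choices_card_less:
  assumes "finite L" "B \<in> junction_choices L" "l \<in> L"
  shows "card (B l) < card L"
proof -
  have "B l \<subseteq> L - {l}" using assms by (auto simp: junction_choices_def PiE_iff)
  then have "B l \<subset> L" using assms by blast
  then show ?thesis using assms by (simp add: psubset_card_mono)
qed

lemma junction_sum_cong:
  assumes "finite L" "\<And>l k. l \<in> L \<Longrightarrow> k < card L \<Longrightarrow> F l k = F' l k"
  shows "junction_sum L F = junction_sum L F'"
  unfolding junction_sum_def
  by (intro sum.cong prod.cong assms(2) refl junction_choices_card_less assms(1))

lemma junction_sum_mono:
  fixes F F' :: "'l \<Rightarrow> nat \<Rightarrow> 'a :: linordered_semidom"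
  assumes "finite L" "\<And>l k. l \<in> L \<Longrightarrow> k < card L \<Longrightarrow> 0 \<le> F l k"
    and "\<And>l k. l \<in> L \<Longrightarrow> k < card L \<Longrightarrow> F l k \<le> F' l k"
  shows "junction_sum L F \<le> junction_sum L F'"
  unfolding junction_sum_def
  by (intro sum_mono prod_mono conjI assms(2,3) junction_choices_card_less assms(1))

lemma junction_sum_scale:
  "junction_sum L (\<lambda>l k. c l * F l k) = (\<Prod>l\<in>L. c l) * junction_sum L F"
  unfolding junction_sum_def by (simp add: prod.distrib sum_distrib_left)

lemma junction_sum_of_nat:
  "junction_sum L (\<lambda>l k. of_nat (F l k)) = of_nat (junction_sum L F)"
  unfolding junction_sum_def by simp

lemma junction_sum_empty [simp]: "junction_sum {} F = 1"
  by (simp add: junction_sum_def junction_choices_def)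

text \<open>\<open>A\<close> stands for the copies blocked at their junction with an eliminated
  copy; expanding the product selects the set \<open>D\<close> of unblocked copies that do cover
  theirs.\<close>

lemma prod_add_unblocked:
  fixes F :: "'l \<Rightarrow> nat \<Rightarrow> 'a :: comm_semiring_1"
  assumes "finite L" "A \<subseteq> L"
  shows "(\<Prod>l\<in>L. (if l \<in> A then F l else (\<lambda>k. F l k + F l (Suc k))) (k l)) =
    (\<Sum>D\<in>Pow (L - A). \<Prod>l\<in>L. F l (k l + of_bool (l \<in> D)))"
proof -
  \<comment> \<open>The second summand is set to 0 on \<open>A\<close>, so that
    \<open>prod_add\<close> expands over all subsets of \<open>L\<close> and those meeting
    \<open>A\<close> vanish.\<close>
  let ?g = "\<lambda>l. if l \<in> A then 0 else F l (Suc (k l))"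
  have split: "(\<Prod>l\<in>L. F l (k l + of_bool (l \<in> D))) =
      (\<Prod>l\<in>D. F l (Suc (k l))) * (\<Prod>l\<in>L-D. F l (k l))" if "D \<subseteq> L" for D
  proof -
    have "(\<Prod>l\<in>L. F l (k l + of_bool (l \<in> D))) =
        (\<Prod>l\<in>L-D. F l (k l + of_bool (l \<in> D))) * (\<Prod>l\<in>D. F l (k l + of_bool (l \<in> D)))"
      by (rule prod.subset_diff[OF that assms(1)])
    also have "\<dots> = (\<Prod>l\<in>L-D. F l (k l)) * (\<Prod>l\<in>D. F l (Suc (k l)))"
      by (intro arg_cong2[where f = "(*)"] prod.cong) auto
    finally show ?thesis by (simp add: mult.commute)
  qed
  have "(\<Prod>l\<in>L. (if l \<in> A then F l else (\<lambda>k. F l k + F l (Suc k))) (k l)) = (\<Prod>l\<in>L. ?g l + F l (k l))"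
    by (intro prod.cong) (auto simp: add.commute)
  also have "\<dots> = (\<Sum>D\<in>Pow L. (\<Prod>l\<in>D. ?g l) * (\<Prod>l\<in>L-D. F l (k l)))"
    by (rule prod_add[OF assms(1)])
  also have "\<dots> = (\<Sum>D\<in>Pow (L - A). (\<Prod>l\<in>D. ?g l) * (\<Prod>l\<in>L-D. F l (k l)))"
  proof (rule sum.mono_neutral_right)
    show "\<forall>D\<in>Pow L - Pow (L - A). (\<Prod>l\<in>D. ?g l) * (\<Prod>l\<in>L-D. F l (k l)) = 0"
    proof
      fix D assume D: "D \<in> Pow L - Pow (L - A)"
      then obtain l where "l \<in> D" "l \<in> A" by blast
      moreover have "finite D" using D assms by (auto intro: finite_subset)
      ultimately have "(\<Prod>l\<in>D. ?g l) = 0" by (intro prod_zero) auto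
      then show "(\<Prod>l\<in>D. ?g l) * (\<Prod>l\<in>L-D. F l (k l)) = 0" by simp
    qed
  qed (use assms in auto)
  also have "\<dots> = (\<Sum>D\<in>Pow (L - A). \<Prod>l\<in>L. F l (k l + of_bool (l \<in> D)))"
  proof (rule sum.cong[OF refl])
    fix D assume D: "D \<in> Pow (L - A)"
    have "(\<Prod>l\<in>D. ?g l) = (\<Prod>l\<in>D. F l (Suc (k l)))" using D by (intro prod.cong) auto
    then show "(\<Prod>l\<in>D. ?g l) * (\<Prod>l\<in>L-D. F l (k l)) = (\<Prod>l\<in>L. F l (k l + of_bool (l \<in> D)))"
      using D split[of D] by (simp add: subset_iff)
  qed
  finally show ?thesis .
qed

text \<open>Elimination of copy \<open>p\<close>: \<open>A\<close> is the set of copies whose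
  junction with \<open>p\<close> is covered by \<open>p\<close>. Such a copy must leave that
  junction free and keeps its weight; any other copy may cover it or not, which adds the weight
  shifted by one.\<close>

lemma junction_sum_insert:
  assumes "finite L" "p \<notin> L"
  shows "junction_sum (insert p L) F =
    (\<Sum>A\<in>Pow L. F p (card A) *
      junction_sum L (\<lambda>l. if l \<in> A then F l else (\<lambda>k. F l k + F l (Suc k))))"
proof -
  define T where "T = (SIGMA A:Pow L. junction_choices L \<times> Pow (L - A))"
  define to where "to = (\<lambda>(A, B, D). \<lambda>l\<in>insert p L. if l = p then A else B l \<union> (if l \<in> D then {p} else {}))"
  define from' where "from' B = (B p, \<lambda>l\<in>L. B l - {p}, {l \<in> L. p \<in> B l})" for B :: "'a \<Rightarrow> 'a set"
  have "(\<Sum>A\<in>Pow L. F p (card A) *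
      junction_sum L (\<lambda>l. if l \<in> A then F l else (\<lambda>k. F l k + F l (Suc k)))) =
     (\<Sum>A\<in>Pow L. \<Sum>B\<in>junction_choices L. \<Sum>D\<in>Pow (L - A).
        F p (card A) * (\<Prod>l\<in>L. F l (card (B l) + of_bool (l \<in> D))))"
    unfolding junction_sum_def sum_distrib_left
  proof (intro sum.cong refl)
    fix A B assume "A \<in> Pow L"
    then show "F p (card A) * (\<Prod>l\<in>L. (if l \<in> A then F l else (\<lambda>k. F l k + F l (Suc k))) (card (B l))) =
        (\<Sum>D\<in>Pow (L - A). F p (card A) * (\<Prod>l\<in>L. F l (card (B l) + of_bool (l \<in> D))))"
      using prod_add_unblocked[of L A F "\<lambda>l. card (B l)"] assms(1) by (simp only: Pow_iff sum_distrib_left)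
  qed
  also have "\<dots> = (\<Sum>(A, B, D)\<in>T. F p (card A) * (\<Prod>l\<in>L. F l (card (B l) + of_bool (l \<in> D))))"
    unfolding T_def using assms
    by (simp add: sum.Sigma finite_junction_choices case_prod_unfold sum.cartesian_product)
  also have "\<dots> = (\<Sum>B\<in>junction_choices (insert p L). \<Prod>l\<in>insert p L. F l (card (B l)))"
  proof (rule sum.reindex_bij_witness[where i = from' and j = to])
    fix t assume t: "t \<in> T"
    obtain A B D where t_eq: "t = (A, B, D)" by (cases t)
    have A: "A \<subseteq> L" and D: "D \<subseteq> L - A" and B: "B \<in> junction_choices L"
      using t by (auto simp: T_def t_eq)
    have BL: "B l \<subseteq> L - {l}" if "l \<in> L" for l
      using B that by (auto simp: junction_choices_def PiE_iff)
    have BB: "l \<notin> B m" if "l \<in> L" "m \<in> B l" for l m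
      using B that by (auto simp: junction_choices_def)
    have Bext: "B \<in> extensional L" using B by (auto simp: junction_choices_def PiE_iff)
    have to_p: "to t p = A" by (simp add: to_def t_eq)
    have to_l: "to t l = B l \<union> (if l \<in> D then {p} else {})" if "l \<in> L" for l
      using that assms by (auto simp: to_def t_eq)
    show "from' (to t) = t"
    proof -
      have "(\<lambda>l\<in>L. to t l - {p}) = B"
      proof (rule extensionalityI[of _ L])
        fix l assume "l \<in> L"
        then show "(\<lambda>l\<in>L. to t l - {p}) l = B l" using BL[of l] assms by (auto simp: to_l)
      qed (simp_all add: Bext)
      moreover have "{l \<in> L. p \<in> to t l} = D"
      proof (intro equalityI subsetI)
        fix l assume "l \<in> {l \<in> L. p \<in> to t l}"
        then show "l \<in> D" using BL[of l] assms by (auto simp: to_l split: if_splits)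
      next
        fix l assume "l \<in> D"
        then show "l \<in> {l \<in> L. p \<in> to t l}" using D by (auto simp: to_l)
      qed
      ultimately show ?thesis using to_p by (simp add: from'_def t_eq)
    qed
    show "to t \<in> junction_choices (insert p L)"
    proof -
      have "to t l \<subseteq> insert p L - {l}" if "l \<in> insert p L" for l
        using that A BL[of l] assms to_l[of l] by (auto simp: to_p split: if_splits)
      moreover have "to t \<in> extensional (insert p L)" by (simp add: to_def t_eq)
      moreover have "l \<notin> to t m" if lm: "l \<in> insert p L" "m \<in> to t l" for l m
      proof (cases "l = p")
        case True
        then have "m \<in> A" using lm by (simp add: to_p)
        then have "m \<in> L" "m \<notin> D" using A D by auto
        then show ?thesis using True BL[of m] assms by (auto simp: to_l)
      next
        case False
        then have l: "l \<in> L" using lm by simp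
        show ?thesis
        proof (cases "m = p")
          case True
          then have "l \<in> D" using lm l BL[OF l] assms by (auto simp: to_l split: if_splits)
          then show ?thesis using True D by (auto simp: to_p)
        next
          case False
          then have "m \<in> B l" using lm l by (auto simp: to_l split: if_splits)
          moreover from this have "m \<in> L" using BL[OF l] by auto
          ultimately show ?thesis using BB[OF l] \<open>l \<noteq> p\<close> by (auto simp: to_l)
        qed
      qed
      ultimately show ?thesis by (auto simp: junction_choices_def PiE_iff)
    qed
    have "(\<Prod>l\<in>L. F l (card (to t l))) = (\<Prod>l\<in>L. F l (card (B l) + of_bool (l \<in> D)))"
    proof (intro prod.cong refl arg_cong[where f = "F _"])
      fix l assume l: "l \<in> L"
      have "finite (B l)" "p \<notin> B l" using BL[OF l] assms by (auto intro: finite_subset)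
      then show "card (to t l) = card (B l) + of_bool (l \<in> D)" by (auto simp: to_l[OF l])
    qed
    then show "(\<Prod>l\<in>insert p L. F l (card (to t l))) =
        (case t of (A, B, D) \<Rightarrow> F p (card A) * (\<Prod>l\<in>L. F l (card (B l) + of_bool (l \<in> D))))"
      using assms by (simp add: t_eq to_p[unfolded t_eq])
  next
    fix B assume B: "B \<in> junction_choices (insert p L)"
    have BL: "B l \<subseteq> insert p L - {l}" if "l \<in> insert p L" for l
      using B that by (auto simp: junction_choices_def PiE_iff)
    have BB: "l \<notin> B m" if "l \<in> insert p L" "m \<in> B l" for l m
      using B that by (auto simp: junction_choices_def)
    have Bext: "B \<in> extensional (insert p L)" using B by (auto simp: junction_choices_def PiE_iff)
    show "to (from' B) = B"
    proof (rule extensionalityI[of _ "insert p L"])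
      fix l assume "l \<in> insert p L"
      then show "to (from' B) l = B l" using assms by (auto simp: to_def from'_def)
    qed (simp_all add: Bext to_def from'_def)
    have "B p \<subseteq> L" using BL[of p] by auto
    moreover have "{l \<in> L. p \<in> B l} \<subseteq> L - B p" using BB by auto
    moreover have "(\<lambda>l\<in>L. B l - {p}) \<in> junction_choices L"
    proof -
      let ?B = "\<lambda>l\<in>L. B l - {p}"
      have sub: "?B l \<subseteq> L - {l}" if "l \<in> L" for l using BL[of l] that by auto
      moreover have "l \<notin> ?B m" if "l \<in> L" "m \<in> ?B l" for l m
      proof -
        have "m \<in> L" "m \<in> B l" using sub[OF that(1)] that by auto
        then show ?thesis using BB[of l m] that(1) by simp
      qed
      moreover have "?B \<in> extensional L" by simp
      ultimately show ?thesis unfolding junction_choices_def PiE_iff by blast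
    qed
    ultimately show "from' B \<in> T" by (auto simp: T_def from'_def)
  qed
  finally show ?thesis by (simp add: junction_sum_def)
qed

text \<open>Induction along the elimination of copies only has to transport subsets
  \<open>A\<close>, whereas a direct bijection would transport set-valued functions in argument and
  value.\<close>

lemma junction_sum_relabel:
  assumes "finite L" "inj_on \<pi> L"
  shows "junction_sum (\<pi> ` L) F = junction_sum L (F \<circ> \<pi>)"
  using assms
proof (induction L arbitrary: F rule: finite_induct)
  case (insert p L)
  have inj: "inj_on \<pi> L" and p: "\<pi> p \<notin> \<pi> ` L" using insert.prems insert.hyps by auto
  have "junction_sum (\<pi> ` insert p L) F = (\<Sum>A\<in>Pow (\<pi> ` L). F (\<pi> p) (card A) *
      junction_sum (\<pi> ` L) (\<lambda>l. if l \<in> A then F l else (\<lambda>k. F l k + F l (Suc k))))"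
    using insert.hyps p by (simp add: junction_sum_insert)
  also have "\<dots> = (\<Sum>A\<in>Pow L. F (\<pi> p) (card (\<pi> ` A)) *
      junction_sum (\<pi> ` L) (\<lambda>l. if l \<in> \<pi> ` A then F l else (\<lambda>k. F l k + F l (Suc k))))"
    unfolding image_Pow_surj[OF refl, symmetric] by (simp add: sum.reindex inj_on_image_Pow[OF inj])
  also have "\<dots> = (\<Sum>A\<in>Pow L. (F \<circ> \<pi>) p (card A) *
      junction_sum L (\<lambda>l. if l \<in> A then (F \<circ> \<pi>) l else (\<lambda>k. (F \<circ> \<pi>) l k + (F \<circ> \<pi>) l (Suc k))))"
  proof (intro sum.cong refl)
    fix A assume A: "A \<in> Pow L"
    then have card_eq: "card (\<pi> ` A) = card A" by (intro card_image inj_on_subset[OF inj]) simp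
    have "\<pi> l \<in> \<pi> ` A \<longleftrightarrow> l \<in> A" if "l \<in> L" for l
      using A that inj by (auto dest: inj_onD)
    then have "junction_sum L ((\<lambda>l. if l \<in> \<pi> ` A then F l else (\<lambda>k. F l k + F l (Suc k))) \<circ> \<pi>) =
        junction_sum L (\<lambda>l. if l \<in> A then (F \<circ> \<pi>) l else (\<lambda>k. (F \<circ> \<pi>) l k + (F \<circ> \<pi>) l (Suc k)))"
      by (intro junction_sum_cong insert.hyps(1)) (simp only: o_def)
    with card_eq show "F (\<pi> p) (card (\<pi> ` A)) *
        junction_sum (\<pi> ` L) (\<lambda>l. if l \<in> \<pi> ` A then F l else (\<lambda>k. F l k + F l (Suc k))) =
      (F \<circ> \<pi>) p (card A) *
        junction_sum L (\<lambda>l. if l \<in> A then (F \<circ> \<pi>) l else (\<lambda>k. (F \<circ> \<pi>) l k + (F \<circ> \<pi>) l (Suc k)))"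
      unfolding insert.IH[OF inj] by (simp only: o_apply)
  qed
  also have "\<dots> = junction_sum (insert p L) (F \<circ> \<pi>)"
    using insert.hyps by (simp add: junction_sum_insert)
  finally show ?case .
qed simp

text \<open>The junctions are independent for geometric weights, and there are
  \<open>card L choose 2\<close> of them. In the induction, eliminating a copy keeps the ratio
  \<open>a\<close> and multiplies the leading factor of each unblocked copy by \<open>1 + a\<close>;
  this is why \<open>C\<close> depends on the copy and is generalised.\<close>

lemma junction_sum_geometric:
  assumes "finite L"
  shows "junction_sum L (\<lambda>l k. C l * a ^ k) = (\<Prod>l\<in>L. C l) * (1 + 2 * a) ^ (card L choose 2)"
  using assms
proof (induction L arbitrary: C rule: finite_induct)
  case (insert p L)
  have step: "(if l \<in> A then (\<lambda>k. C l * a ^ k) else (\<lambda>k. C l * a ^ k + C l * a ^ Suc k)) =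
      (\<lambda>k. (C l * (if l \<in> A then 1 else 1 + a)) * a ^ k)" for l A
    by (auto simp: algebra_simps)
  have pw: "(\<Prod>l\<in>L. if l \<in> A then 1 else 1 + a) = (\<Prod>l\<in>L-A. 1 + a)" if "A \<subseteq> L" for A
    using insert.hyps(1) that by (simp add: prod.If_cases Diff_eq)
  have "junction_sum (insert p L) (\<lambda>l k. C l * a ^ k) = (\<Sum>A\<in>Pow L. C p * a ^ card A *
      ((\<Prod>l\<in>L. C l * (if l \<in> A then 1 else 1 + a)) * (1 + 2 * a) ^ (card L choose 2)))"
    by (simp only: junction_sum_insert[OF insert.hyps(1,2)] step insert.IH)
  also have "\<dots> = (\<Sum>A\<in>Pow L. (C p * (\<Prod>l\<in>L. C l) * (1 + 2 * a) ^ (card L choose 2)) *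
      ((\<Prod>l\<in>A. a) * (\<Prod>l\<in>L-A. 1 + a)))"
    by (intro sum.cong refl) (simp add: prod.distrib pw algebra_simps)
  also have "\<dots> = C p * (\<Prod>l\<in>L. C l) * (1 + 2 * a) ^ (card L choose 2) * (\<Prod>l\<in>L. a + (1 + a))"
    by (simp only: prod_add[OF insert.hyps(1)] sum_distrib_left)
  also have "a + (1 + a) = 1 + 2 * a" by (simp add: mult_2 add_ac)
  also have "C p * (\<Prod>l\<in>L. C l) * (1 + 2 * a) ^ (card L choose 2) * (\<Prod>l\<in>L. 1 + 2 * a) =
      C p * (\<Prod>l\<in>L. C l) * (1 + 2 * a) ^ (card L + (card L choose 2))"
    by (simp add: power_add mult_ac)
  also have "card L + (card L choose 2) = card (insert p L) choose 2"
    using insert.hyps by (simp add: numeral_2_eq_2)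
  finally show ?case using insert.hyps by simp
qed (simp add: binomial_eq_0)

text \<open>Membership in \<open>S\<close> is chosen for each copy independently of
  \<open>B\<close>, so for fixed \<open>B\<close> the sum over \<open>S\<close> is an expanded
  product, with \<open>t\<close> counting the marked copies.\<close>

lemma junction_sum_marked:
  fixes f :: "nat \<Rightarrow> 'a :: comm_semiring_1"
  assumes "finite L"
  shows "(\<Sum>S\<in>Pow L. t ^ card S * junction_sum L (\<lambda>l k. f (k + of_bool (l \<in> S)))) =
    junction_sum L (\<lambda>l k. f k + t * f (Suc k))"
proof -
  have eq: "t ^ card S * (\<Prod>l\<in>L. f (k l + of_bool (l \<in> S))) =
      (\<Prod>l\<in>S. t * f (Suc (k l))) * (\<Prod>l\<in>L-S. f (k l))" if "S \<subseteq> L" for S and k :: "'b \<Rightarrow> nat"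
  proof -
    have "(\<Prod>l\<in>L. f (k l + of_bool (l \<in> S))) =
        (\<Prod>l\<in>L-S. f (k l + of_bool (l \<in> S))) * (\<Prod>l\<in>S. f (k l + of_bool (l \<in> S)))"
      by (rule prod.subset_diff[OF that assms(1)])
    also have "\<dots> = (\<Prod>l\<in>L-S. f (k l)) * (\<Prod>l\<in>S. f (Suc (k l)))"
      by (intro arg_cong2[where f = "(*)"] prod.cong) auto
    finally show ?thesis by (simp add: prod.distrib mult_ac)
  qed
  have "(\<Sum>S\<in>Pow L. t ^ card S * junction_sum L (\<lambda>l k. f (k + of_bool (l \<in> S)))) =
      (\<Sum>B\<in>junction_choices L. \<Sum>S\<in>Pow L. t ^ card S * (\<Prod>l\<in>L. f (card (B l) + of_bool (l \<in> S))))"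
    unfolding junction_sum_def by (subst sum.swap) (simp add: sum_distrib_left)
  also have "\<dots> = (\<Sum>B\<in>junction_choices L. \<Sum>S\<in>Pow L.
      (\<Prod>l\<in>S. t * f (Suc (card (B l)))) * (\<Prod>l\<in>L-S. f (card (B l))))"
    by (intro sum.cong refl eq) auto
  also have "\<dots> = (\<Sum>B\<in>junction_choices L. \<Prod>l\<in>L. t * f (Suc (card (B l))) + f (card (B l)))"
    using assms by (simp add: prod_add)
  finally show ?thesis by (simp add: junction_sum_def add.commute)
qed

subsection \<open>The recursion for the boundary counts\<close>

lemma cnt_Suc_of_card:
  assumes S: "S \<subseteq> {1..d+1}"
    and IH: "\<And>T. T \<subseteq> {1..d+1} \<Longrightarrow> cnt d n T = f (card T)"
  shows "cnt d (Suc n) S = junction_sum {1..d+1} (\<lambda>l k. f (k + of_bool (l \<in> S)))"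
  unfolding cnt_Suc[OF S] junction_sum_def
proof (intro sum.cong prod.cong refl)
  fix B l assume B: "B \<in> junction_choices {1..d+1}" and l: "l \<in> {1..d+1}"
  have Bl: "B l \<subseteq> {1..d+1} - {l}" using B l by (auto simp: junction_choices_def PiE_iff)
  then have "finite (B l)" "l \<notin> B l" by (auto intro: finite_subset)
  then have "card (B l \<union> ({l} \<inter> S)) = card (B l) + of_bool (l \<in> S)" by auto
  moreover have "B l \<union> ({l} \<inter> S) \<subseteq> {1..d+1}" using Bl S by blast
  ultimately show "cnt d n (B l \<union> ({l} \<inter> S)) = f (card (B l) + of_bool (l \<in> S))"
    using IH by simp
qed

section \<open>Level zero: perfect matchings of complete graphs\<close>

definition perfect_matchings :: "'v set \<Rightarrow> 'v set set set" where
  "perfect_matchings X = {M. (\<forall>e\<in>M. card e = 2) \<and> disjoint M \<and> \<Union>M = X}"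

text \<open>The double factorial of \<open>k - 1\<close> for even \<open>k\<close>, and 0 for odd
  \<open>k\<close>.\<close>

fun num_perfect_matchings :: "nat \<Rightarrow> nat" where
  "num_perfect_matchings 0 = 1"
| "num_perfect_matchings (Suc 0) = 0"
| "num_perfect_matchings (Suc (Suc k)) = Suc k * num_perfect_matchings k"

lemma finite_perfect_matchings: "finite X \<Longrightarrow> finite (perfect_matchings X)"
  by (rule finite_subset[of _ "Pow (Pow X)"]) (auto simp: perfect_matchings_def)

text \<open>Classification by the partner \<open>y\<close> of the vertex \<open>x\<close>.\<close>

lemma perfect_matchings_insert:
  assumes "x \<notin> Y"
  shows "perfect_matchings (insert x Y) = (\<Union>y\<in>Y. insert {x, y} ` perfect_matchings (Y - {y}))"
proof (intro equalityI subsetI)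
  fix M assume M: "M \<in> perfect_matchings (insert x Y)"
  then have un: "\<Union>M = insert x Y" and card2: "\<And>e. e \<in> M \<Longrightarrow> card e = 2"
    and disj: "\<And>e f. e \<in> M \<Longrightarrow> f \<in> M \<Longrightarrow> e \<noteq> f \<Longrightarrow> e \<inter> f = {}"
    by (auto simp: perfect_matchings_def disjoint_def)
  obtain e where e: "e \<in> M" "x \<in> e" using un by blast
  then obtain y where y: "e = {x, y}" "x \<noteq> y" using card2[OF e(1)] by (auto simp: card_2_iff)
  have "y \<in> \<Union>M" using e(1) y(1) by blast
  then have "y \<in> Y" using un y(2) by simp
  have "\<Union>(M - {e}) = Y - {y}"
  proof (intro equalityI subsetI)
    fix v assume "v \<in> \<Union>(M - {e})"
    then obtain f where f: "f \<in> M" "f \<noteq> e" "v \<in> f" by blast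
    then have "v \<notin> e" using disj[OF f(1) e(1)] by blast
    then show "v \<in> Y - {y}" using f un y by blast
  next
    fix v assume v: "v \<in> Y - {y}"
    then obtain f where f: "f \<in> M" "v \<in> f" using un by blast
    then show "v \<in> \<Union>(M - {e})" using v y assms by blast
  qed
  then have "M - {e} \<in> perfect_matchings (Y - {y})"
    using card2 disj by (auto simp: perfect_matchings_def disjoint_def)
  moreover have "M = insert {x, y} (M - {e})" using e y by blast
  ultimately show "M \<in> (\<Union>y\<in>Y. insert {x, y} ` perfect_matchings (Y - {y}))"
    using \<open>y \<in> Y\<close> by blast
next
  fix M assume "M \<in> (\<Union>y\<in>Y. insert {x, y} ` perfect_matchings (Y - {y}))"
  then obtain y M' where y: "y \<in> Y" and M': "M' \<in> perfect_matchings (Y - {y})" and M: "M = insert {x, y} M'"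
    by blast
  have "x \<noteq> y" using y assms by blast
  have un: "\<Union>M' = Y - {y}" using M' by (simp add: perfect_matchings_def)
  have "f \<inter> {x, y} = {}" if "f \<in> M'" for f using that un assms by blast
  then have "disjoint M" using M' by (auto simp: M perfect_matchings_def disjoint_def)
  moreover have "\<Union>M = insert x Y" using un y by (auto simp: M)
  moreover have "\<forall>e\<in>M. card e = 2" using M' \<open>x \<noteq> y\<close> by (auto simp: M perfect_matchings_def)
  ultimately show "M \<in> perfect_matchings (insert x Y)" by (simp add: perfect_matchings_def)
qed

lemma card_perfect_matchings:
  "finite X \<Longrightarrow> card (perfect_matchings X) = num_perfect_matchings (card X)"
proof (induction "card X" arbitrary: X rule: less_induct)
  case less
  show ?case
  proof (cases "X = {}")
    case True
    have "perfect_matchings ({} :: 'a set) = {{}}"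
    proof -
      have "M = {}" if "M \<in> perfect_matchings ({} :: 'a set)" for M
        using that by (fastforce simp: perfect_matchings_def)
      then show ?thesis by (auto simp: perfect_matchings_def disjoint_def)
    qed
    then show ?thesis using True by simp
  next
    case False
    then obtain x Y where X: "X = insert x Y" "x \<notin> Y" by (meson Set.set_insert ex_in_conv)
    have "finite Y" using less.prems X by simp
    have "perfect_matchings X = (\<Union>y\<in>Y. insert {x, y} ` perfect_matchings (Y - {y}))"
      using perfect_matchings_insert X by simp
    also have "card \<dots> = (\<Sum>y\<in>Y. card (insert {x, y} ` perfect_matchings (Y - {y})))"
    proof (rule card_UN_disjoint)
      show "\<forall>y\<in>Y. \<forall>z\<in>Y. y \<noteq> z \<longrightarrow>
        insert {x, y} ` perfect_matchings (Y - {y}) \<inter> insert {x, z} ` perfect_matchings (Y - {z}) = {}"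
      proof (intro ballI impI, rule ccontr)
        fix y z assume yz: "y \<in> Y" "z \<in> Y" "y \<noteq> z"
          and "insert {x, y} ` perfect_matchings (Y - {y}) \<inter> insert {x, z} ` perfect_matchings (Y - {z}) \<noteq> {}"
        then obtain M M' where M: "M \<in> perfect_matchings (Y - {y})" and eq: "insert {x, y} M = insert {x, z} M'"
          by blast
        have "{x, z} \<noteq> {x, y}" using yz X by (auto simp: doubleton_eq_iff)
        moreover have "{x, z} \<in> insert {x, y} M" unfolding eq by simp
        ultimately have "{x, z} \<in> M" by simp
        then have "x \<in> \<Union>M" by blast
        moreover have "\<Union>M = Y - {y}" using M by (simp add: perfect_matchings_def)
        ultimately have "x \<in> Y" by simp
        then show False using X by simp
      qed
    qed (simp_all add: \<open>finite Y\<close> finite_perfect_matchings)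
    also have "\<dots> = (\<Sum>y\<in>Y. num_perfect_matchings (card Y - 1))"
    proof (intro sum.cong refl)
      fix y assume y: "y \<in> Y"
      have "inj_on (insert {x, y}) (perfect_matchings (Y - {y}))"
      proof (rule inj_onI)
        fix M M' assume "M \<in> perfect_matchings (Y - {y})" "M' \<in> perfect_matchings (Y - {y})"
          and eq: "insert {x, y} M = insert {x, y} M'"
        then have "{x, y} \<notin> M" "{x, y} \<notin> M'" using X by (auto simp: perfect_matchings_def)
        then show "M = M'" using eq insert_ident by metis
      qed
      then have "card (insert {x, y} ` perfect_matchings (Y - {y})) = card (perfect_matchings (Y - {y}))"
        by (rule card_image)
      also have "\<dots> = num_perfect_matchings (card (Y - {y}))"
      proof (rule less.hyps)
        have "card (Y - {y}) \<le> card Y" by (rule card_Diff1_le)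
        then show "card (Y - {y}) < card X" using X \<open>finite Y\<close> by simp
        show "finite (Y - {y})" using \<open>finite Y\<close> by simp
      qed
      finally show "card (insert {x, y} ` perfect_matchings (Y - {y})) = num_perfect_matchings (card Y - 1)"
        using y by simp
    qed
    also have "\<dots> = num_perfect_matchings (card X)"
      using X \<open>finite Y\<close> by (cases "card Y") simp_all
    finally show ?thesis .
  qed
qed

text \<open>All pairs of vertices are edges of the complete graph and all its vertices are outmost,
  so a configuration covering exactly \<open>S\<close> is a perfect matching of
  \<open>S\<close>.\<close>

lemma cnt_0:
  assumes S: "S \<subseteq> {1..d+1}"
  shows "cnt d 0 S = num_perfect_matchings (card S)"
proof -
  let ?w = "\<lambda>l :: nat. [l]"
  have E: "e \<in> edges (SG d 0) \<longleftrightarrow> (\<exists>u\<in>{1..d+1}. \<exists>v\<in>{1..d+1}. u \<noteq> v \<and> e = {?w u, ?w v})" for e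
  proof
    assume "e \<in> edges (SG d 0)"
    then obtain a b where ab: "a \<in> outmost 0 ` {1..d+1}" "b \<in> outmost 0 ` {1..d+1}" "a \<noteq> b" "e = {a, b}"
      unfolding SG.simps complete_graph_def snd_conv mem_Collect_eq by metis
    then obtain u v where "u \<in> {1..d+1}" "a = ?w u" "v \<in> {1..d+1}" "b = ?w v"
      by (metis imageE outmost.simps(1))
    then show "\<exists>u\<in>{1..d+1}. \<exists>v\<in>{1..d+1}. u \<noteq> v \<and> e = {?w u, ?w v}" using ab by metis
  next
    assume "\<exists>u\<in>{1..d+1}. \<exists>v\<in>{1..d+1}. u \<noteq> v \<and> e = {?w u, ?w v}"
    then obtain u v where uv: "u \<in> {1..d+1}" "v \<in> {1..d+1}" "u \<noteq> v" "e = {outmost 0 u, outmost 0 v}"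
      by auto
    then have "outmost 0 u \<noteq> outmost 0 v" by simp
    then show "e \<in> edges (SG d 0)" using uv
      unfolding SG.simps complete_graph_def snd_conv mem_Collect_eq by (metis imageI)
  qed
  have "{M \<in> dimer_monomers (SG d 0). covered d 0 M = S} = perfect_matchings (?w ` S)"
  proof (intro equalityI subsetI)
    fix M assume "M \<in> {M \<in> dimer_monomers (SG d 0). covered d 0 M = S}"
    then have M: "M \<in> dimer_monomers (SG d 0)" and cov: "covered d 0 M = S" by auto
    have sub: "M \<subseteq> edges (SG d 0)" and disj: "\<And>e f v. e \<in> M \<Longrightarrow> f \<in> M \<Longrightarrow> v \<in> e \<Longrightarrow> v \<in> f \<Longrightarrow> e = f"
      using M unfolding dimer_monomers_SG_iff by blast+
    have in_S: "[l] \<in> \<Union>M \<longleftrightarrow> l \<in> S" if "l \<in> {1..d+1}" for l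
      using cov that by (auto simp: covered_def)
    have "\<Union>M = ?w ` S"
    proof (intro equalityI subsetI)
      fix v assume v: "v \<in> \<Union>M"
      then obtain e where "e \<in> edges (SG d 0)" "v \<in> e" using sub by blast
      then obtain l where l: "l \<in> {1..d+1}" "v = ?w l" unfolding E by blast
      then have "l \<in> S" using in_S[OF l(1)] v by simp
      then show "v \<in> ?w ` S" using l by simp
    next
      fix v assume "v \<in> ?w ` S"
      then obtain l where l: "l \<in> S" "v = ?w l" by blast
      have "l \<in> {1..d+1}" by (rule subsetD[OF S l(1)])
      then show "v \<in> \<Union>M" using in_S l by simp
    qed
    moreover have "\<forall>e\<in>M. card e = 2"
    proof
      fix e assume "e \<in> M"
      then have "e \<in> edges (SG d 0)" by (rule subsetD[OF sub])
      then show "card e = 2" using edges_SG by blast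
    qed
    moreover have "disjoint M"
    proof (rule disjointI)
      fix e f assume "e \<in> M" "f \<in> M" "e \<noteq> f"
      then show "e \<inter> f = {}" using disj[of e f] by blast
    qed
    ultimately show "M \<in> perfect_matchings (?w ` S)" by (simp add: perfect_matchings_def)
  next
    fix M assume "M \<in> perfect_matchings (?w ` S)"
    then have un: "\<Union>M = ?w ` S" and card2: "\<And>e. e \<in> M \<Longrightarrow> card e = 2"
      and disj: "\<And>e f. e \<in> M \<Longrightarrow> f \<in> M \<Longrightarrow> e \<noteq> f \<Longrightarrow> e \<inter> f = {}"
      by (auto simp: perfect_matchings_def disjoint_def)
    have "e \<in> edges (SG d 0)" if e: "e \<in> M" for e
    proof -
      obtain a b where ab: "e = {a, b}" "a \<noteq> b" using card2[OF e] by (auto simp: card_2_iff)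
      then have "a \<in> \<Union>M" "b \<in> \<Union>M" using e by blast+
      then obtain u v where "a = ?w u" "b = ?w v" "u \<in> S" "v \<in> S" unfolding un by blast
      then show ?thesis unfolding E using ab S by blast
    qed
    then have "M \<in> dimer_monomers (SG d 0)" unfolding dimer_monomers_SG_iff using disj by blast
    moreover have "covered d 0 M = S" unfolding covered_def un using S by auto
    ultimately show "M \<in> {M \<in> dimer_monomers (SG d 0). covered d 0 M = S}" by simp
  qed
  then have "cnt d 0 S = num_perfect_matchings (card (?w ` S))"
    using finite_subset[OF S] by (simp add: cnt_def card_perfect_matchings)
  also have "card (?w ` S) = card S" by (rule card_image) (simp add: inj_on_def)
  finally show ?thesis .
qed

section \<open>Symmetry of the counts in the labels\<close>

lemma ex_bij_betw_image:
  assumes "finite L" "S \<subseteq> L" "T \<subseteq> L" "card S = card T"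
  shows "\<exists>\<pi>. bij_betw \<pi> L L \<and> \<pi> ` S = T"
proof -
  have fin: "finite S" "finite T" using assms by (auto intro: finite_subset)
  obtain g where g: "bij_betw g S T" using finite_same_card_bij[OF fin assms(4)] by blast
  have "card (L - S) = card (L - T)" using assms fin by (simp add: card_Diff_subset)
  then obtain h where h: "bij_betw h (L - S) (L - T)"
    using finite_same_card_bij[of "L - S" "L - T"] assms by auto
  have "bij_betw (\<lambda>x. if x \<in> S then g x else h x) (S \<union> (L - S)) (T \<union> (L - T))"
    using g h by (rule bij_betw_disjoint_Un) auto
  moreover have "S \<union> (L - S) = L" "T \<union> (L - T) = L" using assms by auto
  moreover have "(\<lambda>x. if x \<in> S then g x else h x) ` S = T" using g by (auto simp: bij_betw_def)
  ultimately show ?thesis by auto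
qed

text \<open>The set \<open>{1..k}\<close> represents all sets of \<open>k\<close> labels; labels
  start at 1, so \<open>l \<le> k\<close> tests membership. The semiring is left open because the
  step is used on natural numbers for exact counts and on reals for bounds.\<close>

definition gasket_step :: "nat \<Rightarrow> (nat \<Rightarrow> 'a) \<Rightarrow> nat \<Rightarrow> 'a :: comm_semiring_1" where
  "gasket_step d f k = junction_sum {1..d+1} (\<lambda>l j. f (j + of_bool (l \<le> k)))"

lemma junction_sum_eq_gasket_step:
  assumes "S \<subseteq> {1..d+1}"
  shows "junction_sum {1..d+1} (\<lambda>l j. f (j + of_bool (l \<in> S))) = gasket_step d f (card S)"
proof -
  let ?L = "{1..d+1}" and ?T = "{1..card S}"
  have "card S \<le> d + 1" using card_mono[OF _ assms] by simp
  then have T: "?T \<subseteq> ?L" by auto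
  obtain \<pi> where \<pi>: "bij_betw \<pi> ?L ?L" "\<pi> ` S = ?T"
    using ex_bij_betw_image[of ?L S ?T] assms T by auto
  have "gasket_step d f (card S) = junction_sum ?L (\<lambda>l k. f (k + of_bool (l \<in> ?T)))"
    unfolding gasket_step_def by (intro junction_sum_cong) auto
  also have "\<dots> = junction_sum (\<pi> ` ?L) (\<lambda>l k. f (k + of_bool (l \<in> ?T)))"
    using \<pi> by (simp add: bij_betw_def)
  also have "\<dots> = junction_sum ?L ((\<lambda>l k. f (k + of_bool (l \<in> ?T))) \<circ> \<pi>)"
    using \<pi> by (intro junction_sum_relabel) (auto simp: bij_betw_def)
  also have "\<dots> = junction_sum ?L (\<lambda>l k. f (k + of_bool (l \<in> S)))"
  proof (rule junction_sum_cong)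
    fix l k assume l: "l \<in> ?L"
    have "\<pi> l \<in> ?T \<longleftrightarrow> l \<in> S"
      unfolding \<pi>(2)[symmetric] using l assms \<pi>(1) inj_on_image_mem_iff[of \<pi> ?L l S]
      by (auto simp: bij_betw_def)
    then show "((\<lambda>l k. f (k + of_bool (l \<in> ?T))) \<circ> \<pi>) l k = f (k + of_bool (l \<in> S))"
      by (simp only: o_def)
  qed simp
  finally show ?thesis by simp
qed

definition boundary_count :: "nat \<Rightarrow> nat \<Rightarrow> nat \<Rightarrow> nat" where
  "boundary_count d n k = cnt d n {1..k}"

text \<open>The vertex names are not invariant under permuting labels, since \<open>glue\<close>
  prefers the smaller one. Symmetry is instead inherited from level zero through the recursion, as
  junction sums are invariant under relabelling.\<close>

lemma cnt_eq_boundary_count: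
  "S \<subseteq> {1..d+1} \<Longrightarrow> cnt d n S = boundary_count d n (card S)"
proof (induction n arbitrary: S)
  case 0
  have "card S \<le> d + 1" using card_mono[OF _ 0] by simp
  then have "{1..card S} \<subseteq> {1..d+1}" by auto
  then show ?case using cnt_0[OF 0] by (simp add: boundary_count_def cnt_0)
next
  case (Suc n)
  have "card S \<le> d + 1" using card_mono[OF _ Suc.prems] by simp
  then have T: "{1..card S} \<subseteq> {1..d+1}" by auto
  have "cnt d (Suc n) T = gasket_step d (boundary_count d n) (card T)" if "T \<subseteq> {1..d+1}" for T
    using cnt_Suc_of_card[OF that Suc.IH] junction_sum_eq_gasket_step[OF that] by simp
  from this[OF T] this[OF Suc.prems] show ?case by (simp add: boundary_count_def)
qed

lemma boundary_count_Suc: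
  assumes "k \<le> d + 1"
  shows "boundary_count d (Suc n) k = gasket_step d (boundary_count d n) k"
proof -
  have "{1..k} \<subseteq> {1..d+1}" using assms by auto
  then have "cnt d (Suc n) {1..k} = gasket_step d (boundary_count d n) (card {1..k})"
    using cnt_Suc_of_card[OF _ cnt_eq_boundary_count] junction_sum_eq_gasket_step by metis
  then show ?thesis by (simp add: boundary_count_def)
qed

section \<open>Number of vertices of the gasket\<close>

lemma card_verts_SG_Suc:
  "card (verts (SG d (Suc n))) = (\<Sum>l\<in>{1..d+1}. card (verts (SG d n)) - (l - 1))"
proof -
  let ?V = "verts (SG d n)"
  \<comment> \<open>Each shared vertex is credited to the copy with the smaller label, so copy
    \<open>l\<close> gives up the \<open>l - 1\<close> vertices it shares with smaller
    labels.\<close>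
  define W where "W l = glue n l ` (?V - outmost n ` {1..<l})" for l
  have "verts (SG d (Suc n)) = (\<Union>l\<in>{1..d+1}. W l)"
  proof (intro equalityI subsetI)
    fix v assume "v \<in> verts (SG d (Suc n))"
    then obtain l x where l: "l \<in> {1..d+1}" and x: "x \<in> ?V" and v: "v = glue n l x"
      unfolding SG.simps fst_conv by blast
    show "v \<in> (\<Union>l\<in>{1..d+1}. W l)"
    proof (cases "x \<in> outmost n ` {1..<l}")
      case True
      then obtain m where m: "m \<in> {1..<l}" "x = outmost n m" by blast
      then have "v = glue n m (outmost n l)" using v by (auto simp: glue_eq_iff)
      moreover have "outmost n l \<in> ?V" using outmost_in_SG[OF l] .
      moreover have "outmost n l \<notin> outmost n ` {1..<m}" using m by auto
      ultimately have "v \<in> W m" by (simp add: W_def)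
      then show ?thesis using m l by (intro UN_I[of m]) auto
    next
      case False
      then have "v \<in> W l" using x v by (simp add: W_def)
      then show ?thesis using l by blast
    qed
  next
    fix v assume "v \<in> (\<Union>l\<in>{1..d+1}. W l)"
    then show "v \<in> verts (SG d (Suc n))" unfolding W_def SG.simps fst_conv by blast
  qed
  also have "card (\<Union>l\<in>{1..d+1}. W l) = (\<Sum>l\<in>{1..d+1}. card (W l))"
  proof (rule card_UN_disjoint)
    have "W l \<inter> W m = {}" if "l < m" "l \<in> {1..d+1}" for l m
      using that by (auto simp: W_def glue_eq_iff)
    then show "\<forall>l\<in>{1..d+1}. \<forall>m\<in>{1..d+1}. l \<noteq> m \<longrightarrow> W l \<inter> W m = {}"
      by (metis Int_commute nat_neq_iff)
  qed (simp_all add: W_def finite_verts_SG)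
  also have "\<dots> = (\<Sum>l\<in>{1..d+1}. card ?V - (l - 1))"
  proof (intro sum.cong refl)
    fix l assume l: "l \<in> {1..d+1}"
    have "inj_on (glue n l) (?V - outmost n ` {1..<l})" by (auto simp: inj_on_def glue_eq_iff)
    then have "card (W l) = card (?V - outmost n ` {1..<l})" unfolding W_def by (rule card_image)
    also have "outmost n ` {1..<l} \<subseteq> ?V" using l by (auto intro!: outmost_in_SG)
    then have "card (?V - outmost n ` {1..<l}) = card ?V - card (outmost n ` {1..<l})"
      by (intro card_Diff_subset) auto
    also have "card (outmost n ` {1..<l}) = l - 1" by (subst card_image) (auto simp: inj_on_def)
    finally show "card (W l) = card ?V - (l - 1)" .
  qed
  finally show ?thesis .
qed

lemma card_verts_SG:
  "real (card (verts (SG d n))) = (real d + 1) / 2 * ((real d + 1) ^ n + 1)"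
proof (induction n)
  case 0
  have "card (outmost 0 ` {1..d+1}) = d + 1" by (subst card_image) (auto simp: inj_on_def)
  then show ?case by (simp add: complete_graph_def)
next
  case (Suc n)
  \<comment> \<open>Ensures that the natural-number subtraction in \<open>card_verts_SG_Suc\<close>
    does not truncate.\<close>
  have ge: "d + 1 \<le> card (verts (SG d n))"
  proof -
    have "card (outmost n ` {1..d+1}) \<le> card (verts (SG d n))"
      by (intro card_mono finite_verts_SG image_subsetI outmost_in_SG)
    moreover have "card (outmost n ` {1..d+1}) = d + 1" by (subst card_image) (auto simp: inj_on_def)
    ultimately show ?thesis by simp
  qed
  have "real (card (verts (SG d (Suc n)))) = (\<Sum>l\<in>{1..d+1}. real (card (verts (SG d n))) - (real l - 1))"
    unfolding card_verts_SG_Suc of_nat_sum using ge by (intro sum.cong refl) (auto simp: of_nat_diff)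
  also have "\<dots> = (real d + 1) * real (card (verts (SG d n))) - (\<Sum>l\<in>{1..d+1}. real l - 1)"
    by (simp add: sum_subtractf)
  also have "(\<Sum>l\<in>{1..d+1}. real l - 1) = real d * (real d + 1) / 2"
    by (induction d) (simp_all add: field_simps)
  finally show ?case unfolding Suc.IH by (simp add: field_simps)
qed

lemma sum_Pow_insert:
  assumes "finite L" "x \<notin> L"
  shows "(\<Sum>A\<in>Pow (insert x L). g A) = (\<Sum>A\<in>Pow L. g A + g (insert x A))"
proof -
  have "inj_on (insert x) (Pow L)" using assms(2) by (intro inj_onI) (auto simp: insert_ident)
  moreover have "Pow L \<inter> insert x ` Pow L = {}" using assms(2) by auto
  ultimately show ?thesis
    using assms(1) by (simp add: Pow_insert sum.union_disjoint sum.reindex sum.distrib)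
qed

subsection \<open>Bounds propagated by the recursion\<close>

text \<open>Homogeneity of degree \<open>d + 1\<close> combined with monotonicity; this and its
  counterpart transfer bounds on truncated counts to the next level.\<close>

lemma gasket_step_scale_le:
  fixes f g :: "nat \<Rightarrow> real"
  assumes "k \<le> d + 1" "0 \<le> c" "\<And>j. 0 \<le> f j" "\<And>j. j \<le> d + 1 \<Longrightarrow> c * f j \<le> g j"
  shows "c ^ (d + 1) * gasket_step d f k \<le> gasket_step d g k"
proof -
  have "c ^ (d + 1) * gasket_step d f k = junction_sum {1..d+1} (\<lambda>l j. c * f (j + of_bool (l \<le> k)))"
    unfolding gasket_step_def by (subst junction_sum_scale) simp
  also have "\<dots> \<le> gasket_step d g k"
    unfolding gasket_step_def using assms by (intro junction_sum_mono) auto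
  finally show ?thesis .
qed

lemma gasket_step_le_scale:
  fixes f g :: "nat \<Rightarrow> real"
  assumes "k \<le> d + 1" "\<And>j. 0 \<le> g j" "\<And>j. j \<le> d + 1 \<Longrightarrow> g j \<le> c * f j"
  shows "gasket_step d g k \<le> c ^ (d + 1) * gasket_step d f k"
proof -
  have "gasket_step d g k \<le> junction_sum {1..d+1} (\<lambda>l j. c * f (j + of_bool (l \<le> k)))"
    unfolding gasket_step_def using assms by (intro junction_sum_mono) auto
  also have "\<dots> = c ^ (d + 1) * gasket_step d f k"
    unfolding gasket_step_def by (subst junction_sum_scale) simp
  finally show ?thesis .
qed

definition ratios_between :: "nat \<Rightarrow> real \<Rightarrow> real \<Rightarrow> (nat \<Rightarrow> real) \<Rightarrow> bool" where
  "ratios_between d a b f \<longleftrightarrow> (\<forall>k\<le>d. a * f k \<le> f (Suc k) \<and> f (Suc k) \<le> b * f k)"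

text \<open>Passing from \<open>k\<close> to \<open>Suc k\<close> changes only the weight of the
  copy labelled \<open>Suc k\<close>, from \<open>f j\<close> to \<open>f (Suc j)\<close>. Attaching
  the factor \<open>a\<close> or \<open>b\<close> to that copy alone makes the two sums comparable
  summand by summand.\<close>

lemma ratios_between_gasket_step:
  assumes f: "ratios_between d a b f" and "0 \<le> a" "\<And>k. 0 \<le> f k"
  shows "ratios_between d a b (gasket_step d f)"
  unfolding ratios_between_def
proof (intro allI impI)
  fix k assume k: "k \<le> d"
  have scale: "c * gasket_step d f k =
      junction_sum {1..d+1} (\<lambda>l j. (if l = Suc k then c else 1) * f (j + of_bool (l \<le> k)))" for c
    unfolding gasket_step_def using k by (subst junction_sum_scale) simp
  have ratio: "a * f j \<le> f (Suc j)" "f (Suc j) \<le> b * f j" if "j < d + 1" for j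
    using f that by (auto simp: ratios_between_def)
  have "a * gasket_step d f k \<le> gasket_step d f (Suc k)"
    unfolding scale unfolding gasket_step_def
    using ratio(1) assms(2,3) by (intro junction_sum_mono) (auto simp: le_Suc_eq)
  moreover have "gasket_step d f (Suc k) \<le> b * gasket_step d f k"
    unfolding scale unfolding gasket_step_def
    using ratio(2) assms(3) by (intro junction_sum_mono) (auto simp: le_Suc_eq)
  ultimately show "a * gasket_step d f k \<le> gasket_step d f (Suc k) \<and>
      gasket_step d f (Suc k) \<le> b * gasket_step d f k" by blast
qed

lemma ratios_between_power:
  assumes "ratios_between d a b f" "0 \<le> a" "0 \<le> b" "k \<le> d + 1"
  shows "f 0 * a ^ k \<le> f k \<and> f k \<le> f 0 * b ^ k"
  using assms(4)
proof (induction k)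
  case (Suc k)
  then have "a * f k \<le> f (Suc k)" "f (Suc k) \<le> b * f k"
    using assms(1) by (auto simp: ratios_between_def)
  moreover have "a * (f 0 * a ^ k) \<le> a * f k" "b * f k \<le> b * (f 0 * b ^ k)"
    using Suc assms by (auto intro!: mult_left_mono)
  ultimately show ?case by (simp add: mult_ac)
qed simp

text \<open>At \<open>k = 0\<close> every copy carries \<open>f\<close> itself, which lies between
  the geometric sequences \<open>f 0 * a ^ k\<close> and \<open>f 0 * b ^ k\<close>.\<close>

lemma gasket_step_0_bounds:
  assumes f: "ratios_between d a b f" and "0 \<le> a" "0 \<le> b" "\<And>k. 0 \<le> f k"
  shows "f 0 ^ (d + 1) * (1 + 2 * a) ^ ((d + 1) choose 2) \<le> gasket_step d f 0"
    and "gasket_step d f 0 \<le> f 0 ^ (d + 1) * (1 + 2 * b) ^ ((d + 1) choose 2)"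
proof -
  have step: "gasket_step d f 0 = junction_sum {1..d+1} (\<lambda>l. f)"
    unfolding gasket_step_def by (intro junction_sum_cong) auto
  have geo: "f 0 ^ (d + 1) * (1 + 2 * c) ^ ((d + 1) choose 2) = junction_sum {1..d+1} (\<lambda>l k. f 0 * c ^ k)" for c
    by (subst junction_sum_geometric) simp_all
  show "f 0 ^ (d + 1) * (1 + 2 * a) ^ ((d + 1) choose 2) \<le> gasket_step d f 0"
    unfolding step geo using ratios_between_power[OF f] assms by (intro junction_sum_mono) auto
  show "gasket_step d f 0 \<le> f 0 ^ (d + 1) * (1 + 2 * b) ^ ((d + 1) choose 2)"
    unfolding step geo using ratios_between_power[OF f] assms by (intro junction_sum_mono) auto
qed

lemma of_nat_gasket_step: "of_nat (gasket_step d f k) = gasket_step d (\<lambda>j. of_nat (f j)) k"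
  unfolding gasket_step_def by (rule junction_sum_of_nat[symmetric])

subsection \<open>Generating polynomial of the boundary counts\<close>

lemma sum_Pow_card:
  assumes "finite L"
  shows "(\<Sum>S\<in>Pow L. g (card S)) = (\<Sum>k\<le>card L. of_nat (card L choose k) * (g k :: 'a :: comm_semiring_1))"
proof -
  have "(\<Sum>S\<in>Pow L. g (card S)) = (\<Sum>k\<le>card L. \<Sum>S\<in>{S \<in> Pow L. card S = k}. g (card S))"
    by (rule sum.group[symmetric]) (auto simp: assms card_mono)
  also have "\<dots> = (\<Sum>k\<le>card L. of_nat (card L choose k) * g k)"
  proof (intro sum.cong refl)
    fix k
    have "(\<Sum>S\<in>{S \<in> Pow L. card S = k}. g (card S)) = (\<Sum>S\<in>{S \<in> Pow L. card S = k}. g k)"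
      by (intro sum.cong) auto
    also have "\<dots> = of_nat (card L choose k) * g k"
      using n_subsets[OF assms, of k] by (simp add: Pow_def)
    finally show "(\<Sum>S\<in>{S \<in> Pow L. card S = k}. g (card S)) = of_nat (card L choose k) * g k" .
  qed
  finally show ?thesis .
qed

text \<open>
  Attaching a formal weight to each covered outmost vertex packs the values of \<open>gasket_step\<close> at all
  \<open>k\<close> into a single junction sum over polynomials, which moreover is symmetric in the copies.
\<close>

lemma coeff_junction_sum_linear:
  fixes f :: "nat \<Rightarrow> nat"
  assumes "k \<le> d + 1"
  shows "coeff (junction_sum {1..d+1} (\<lambda>l j. [:f j, f (Suc j):])) k = ((d + 1) choose k) * gasket_step d f k"
proof -
  let ?L = "{1..d+1}" and ?t = "[:0, 1:] :: nat poly"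
  have lin: "[:f j, f (Suc j):] = of_nat (f j) + ?t * of_nat (f (Suc j))" for j
    by (simp add: of_nat_poly)
  have "junction_sum ?L (\<lambda>l j. [:f j, f (Suc j):]) =
      (\<Sum>S\<in>Pow ?L. ?t ^ card S * junction_sum ?L (\<lambda>l j. of_nat (f (j + of_bool (l \<in> S)))))"
    unfolding lin by (rule junction_sum_marked[symmetric]) simp
  also have "\<dots> = (\<Sum>S\<in>Pow ?L. ?t ^ card S * of_nat (gasket_step d f (card S)))"
    by (intro sum.cong refl) (simp only: junction_sum_of_nat Pow_iff junction_sum_eq_gasket_step)
  also have "\<dots> = (\<Sum>i\<le>d+1. of_nat ((d + 1) choose i) * (?t ^ i * of_nat (gasket_step d f i)))"
    by (subst sum_Pow_card) simp_all
  also have "\<dots> = (\<Sum>i\<le>d+1. monom (((d + 1) choose i) * gasket_step d f i) i)"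
    by (intro sum.cong refl) (simp add: monom_altdef of_nat_poly mult_ac)
  also have "coeff \<dots> k = (\<Sum>i\<le>d+1. if i = k then ((d + 1) choose i) * gasket_step d f i else 0)"
    by (simp add: coeff_sum)
  also have "\<dots> = ((d + 1) choose k) * gasket_step d f k" using assms by simp
  finally show ?thesis .
qed

section \<open>Explicit junction sums for up to five copies\<close>

definition shift_add :: "(nat \<Rightarrow> 'a :: comm_semiring_1) \<Rightarrow> nat \<Rightarrow> 'a" where
  "shift_add f k = f k + f (Suc k)"

lemma junction_sum_1: "junction_sum {p} F = F p 0"
  by (simp add: junction_sum_insert)

lemma junction_sum_2:
  assumes "p \<noteq> q"
  shows "junction_sum {p, q} F = F p 0 * (F q 0 + F q 1) + F p 1 * F q 0"
  using assms by (simp add: junction_sum_insert sum_Pow_insert junction_sum_1)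

text \<open>The first of three copies is eliminated: \<open>f0\<close>, \<open>f1\<close>,
  \<open>f2\<close> multiply the cases where it covers 0, 1, 2 of its junctions. Three values per
  copy suffice, as each has two junctions. Common sums are named so that evaluation computes them
  once.\<close>

fun triple_sum :: "'a \<times> 'a \<times> 'a \<Rightarrow> 'a \<times> 'a \<times> 'a \<Rightarrow> 'a \<times> 'a \<times> 'a \<Rightarrow> 'a :: comm_semiring_1" where
  "triple_sum (f0, f1, f2) (g0, g1, g2) (h0, h1, h2) =
    (let g01 = g0 + g1; g12 = g1 + g2; h01 = h0 + h1; h012 = h01 + (h1 + h2); u = g01 * h01 in
      f0 * (g01 * h012 + g12 * h01) +
      f1 * (g0 * h012 + g1 * h01 + (u + g12 * h0)) +
      f2 * (g0 * h01 + g1 * h0))"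

lemma triple_sum_commute: "triple_sum x y z = triple_sum y x z"
  by (cases x; cases y; cases z) (simp add: Let_def algebra_simps)

lemma triple_sum_right_commute: "triple_sum x y z = triple_sum x z y"
  by (cases x; cases y; cases z) (simp add: Let_def algebra_simps)

definition heads :: "(nat \<Rightarrow> 'a) \<Rightarrow> 'a \<times> 'a \<times> 'a" where
  "heads f = (f 0, f 1, f 2)"

lemma junction_sum_3:
  assumes "p \<noteq> q" "p \<noteq> r" "q \<noteq> r"
  shows "junction_sum {p, q, r} F = triple_sum (heads (F p)) (heads (F q)) (heads (F r))"
  using assms
  by (simp add: junction_sum_insert[of "{q, r}"] sum_Pow_insert junction_sum_2 heads_def Let_def
      numeral_2_eq_2 algebra_simps)

definition quad_sum :: "(nat \<Rightarrow> 'a) \<Rightarrow> (nat \<Rightarrow> 'a) \<Rightarrow> (nat \<Rightarrow> 'a) \<Rightarrow> (nat \<Rightarrow> 'a) \<Rightarrow> 'a :: comm_semiring_1" where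
  "quad_sum e f g h =
    (let f' = heads (shift_add f); g' = heads (shift_add g); h' = heads (shift_add h);
         f = heads f; g = heads g; h = heads h in
      e 0 * triple_sum f' g' h' +
      e 1 * (triple_sum f g' h' + triple_sum f' g h' + triple_sum f' g' h) +
      e 2 * (triple_sum f g h' + triple_sum f g' h + triple_sum f' g h) +
      e 3 * triple_sum f g h)"

lemma junction_sum_4:
  assumes "p \<noteq> q" "p \<noteq> r" "p \<noteq> s" "q \<noteq> r" "q \<noteq> s" "r \<noteq> s"
  shows "junction_sum {p, q, r, s} F = quad_sum (F p) (F q) (F r) (F s)"
proof -
  have eq: "(\<lambda>k. F l k + F l (Suc k)) = shift_add (F l)" for l by (auto simp: shift_add_def)
  show ?thesis using assms
    by (simp add: junction_sum_insert[of "{q, r, s}"] sum_Pow_insert junction_sum_3 quad_sum_def eq Let_def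
        numeral_2_eq_2 numeral_3_eq_3 algebra_simps)
qed

text \<open>The permuted expressions are junction sums over the same four-element set listed in
  another order, so symmetry follows without expanding the polynomial.\<close>

lemma quad_sum_commute:
  "quad_sum e f g h = quad_sum f e g h"
  "quad_sum e f g h = quad_sum e g f h"
  "quad_sum e f g h = quad_sum e f h g"
proof -
  let ?F = "\<lambda>i :: nat. [e, f, g, h] ! i"
  have "quad_sum e f g h = junction_sum {0, 1, 2, 3} ?F"
    by (subst junction_sum_4) (simp_all add: numeral_2_eq_2 numeral_3_eq_3)
  moreover have "quad_sum f e g h = junction_sum {1, 0, 2, 3} ?F"
    by (subst junction_sum_4) (simp_all add: numeral_2_eq_2 numeral_3_eq_3)
  moreover have "quad_sum e g f h = junction_sum {0, 2, 1, 3} ?F"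
    by (subst junction_sum_4) (simp_all add: numeral_2_eq_2 numeral_3_eq_3)
  moreover have "quad_sum e f h g = junction_sum {0, 1, 3, 2} ?F"
    by (subst junction_sum_4) (simp_all add: numeral_2_eq_2 numeral_3_eq_3)
  ultimately show "quad_sum e f g h = quad_sum f e g h" "quad_sum e f g h = quad_sum e g f h"
    "quad_sum e f g h = quad_sum e f h g"
    by (simp_all add: insert_commute)
qed

text \<open>
  Copies are eliminated one at a time: a copy whose junction with the eliminated one is still open
  has its counts \<open>f\<close> replaced by \<open>shift_add f\<close>. A letter \<open>a\<close>, \<open>b\<close>, \<open>c\<close> stands for a remaining copy
  to which this has happened \<open>0\<close>, \<open>1\<close>, \<open>2\<close> times. Repeated summands replace the coefficients
  \<open>2, 3, 4, 6\<close> since a bare commutative semiring has no normalisation of numeral coefficients.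
\<close>

definition five_sum :: "'a \<Rightarrow> 'a \<Rightarrow> 'a \<Rightarrow> 'a \<Rightarrow> 'a \<Rightarrow> 'a :: comm_semiring_1" where
  "five_sum a0 a1 a2 a3 a4 =
    (let b0 = a0 + a1; b1 = a1 + a2; b2 = a2 + a3; b3 = a3 + a4;
         a = (a0, a1, a2); b = (b0, b1, b2); c = (b0 + b1, b1 + b2, b2 + b3);
         aaa = triple_sum a a a; aab = triple_sum a a b; aac = triple_sum a a c;
         abb = triple_sum a b b; abc = triple_sum a b c; acc = triple_sum a c c;
         bbb = triple_sum b b b; bbc = triple_sum b b c; bcc = triple_sum b c c;
         ccc = triple_sum c c c;
         aaaa = a0 * bbb + a1 * (abb + abb + abb) + a2 * (aab + aab + aab) + a3 * aaa;
         aaab = a0 * bbc + a1 * (abc + abc + bbb) + a2 * (aac + abb + abb) + a3 * aab;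
         aabb = a0 * bcc + a1 * (acc + bbc + bbc) + a2 * (abc + abc + bbb) + a3 * abb;
         abbb = a0 * ccc + a1 * (bcc + bcc + bcc) + a2 * (bbc + bbc + bbc) + a3 * bbb;
         bbbb = b0 * ccc + b1 * (bcc + bcc + bcc) + b2 * (bbc + bbc + bbc) + b3 * bbb
     in a0 * bbbb + a1 * (abbb + abbb + abbb + abbb) +
        a2 * (aabb + aabb + aabb + aabb + aabb + aabb) +
        a3 * (aaab + aaab + aaab + aaab) + a4 * aaaa)"

text \<open>With equal copies, the 16 sets that the eliminated copy can block fall into classes of
  sizes 1, 4, 6, 4, 1.\<close>

lemma junction_sum_5: "junction_sum {1..4+1::nat} (\<lambda>l. f) = five_sum (f 0) (f 1) (f 2) (f 3) (f 4)"
proof -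
  let ?g = "shift_add f"
  have L: "{1..4+1::nat} = {1, 2, 3, 4, 5}" by auto
  have eq: "(\<lambda>k. f k + f (Suc k)) = ?g" by (auto simp: shift_add_def)
  have "junction_sum {1..4+1::nat} (\<lambda>l. f) =
      f 0 * quad_sum ?g ?g ?g ?g +
      f 1 * (quad_sum f ?g ?g ?g + quad_sum f ?g ?g ?g + quad_sum f ?g ?g ?g + quad_sum f ?g ?g ?g) +
      f 2 * (quad_sum f f ?g ?g + quad_sum f f ?g ?g + quad_sum f f ?g ?g + quad_sum f f ?g ?g +
        quad_sum f f ?g ?g + quad_sum f f ?g ?g) +
      f 3 * (quad_sum f f f ?g + quad_sum f f f ?g + quad_sum f f f ?g + quad_sum f f f ?g) +
      f 4 * quad_sum f f f f"
    unfolding L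
    by (subst junction_sum_insert, simp, simp) (simp add: sum_Pow_insert junction_sum_4 eq quad_sum_commute
       eval_nat_numeral algebra_simps)
  also have "\<dots> = five_sum (f 0) (f 1) (f 2) (f 3) (f 4)"
    unfolding five_sum_def quad_sum_def Let_def heads_def shift_add_def
    by (simp add: triple_sum_commute triple_sum_right_commute eval_nat_numeral add_ac del: triple_sum.simps)
  finally show ?thesis .
qed

subsection \<open>Existence of the growth constant\<close>

lemma gasket_growth_constant:
  fixes d m :: nat and a b :: real
  defines "D \<equiv> real (d + 1)" and "x \<equiv> \<lambda>n k. real (boundary_count d n k)"
  assumes d: "d \<ge> 1" and a: "0 \<le> a" "a \<le> b"
    and ratios: "ratios_between d a b (x m)" and pos: "0 < x m 0"
  shows "\<exists>z. (\<lambda>n. ln (real (N_DM (SG d n))) / real (card (verts (SG d n)))) \<longlonglongrightarrow> z \<and>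
    (2 / D * ln (x m 0) + ln (1 + 2 * a)) / D ^ m \<le> z \<and>
    z \<le> (2 / D * ln (x m 0) + ln (1 + 2 * b)) / D ^ m"
proof -
  have D: "D \<ge> 2" using d by (simp add: D_def)
  define C where "C = real ((d + 1) choose 2)"
  have C: "C + D / 2 = D * D / 2"
  proof -
    have "C = real ((d + 1) * d) / 2" unfolding C_def choose_two by (subst real_of_nat_div) auto
    then show ?thesis by (simp add: D_def field_simps)
  qed
  have x_Suc: "x (Suc n) k = gasket_step d (x n) k" if "k \<le> d + 1" for n k
    unfolding x_def using that by (simp only: boundary_count_Suc of_nat_gasket_step)
  have nonneg: "0 \<le> x n k" for n k by (simp add: x_def)
  have ratios_n: "ratios_between d a b (x n)" if "n \<ge> m" for n
    using that
  proof (induction n rule: dec_induct)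
    case (step n)
    have "ratios_between d a b (gasket_step d (x n))"
      using step.IH a(1) nonneg by (rule ratios_between_gasket_step)
    then show ?case unfolding ratios_between_def using x_Suc by simp
  qed (rule ratios)
  have bounds: "x n 0 ^ (d + 1) * (1 + 2 * a) ^ ((d + 1) choose 2) \<le> x (Suc n) 0"
      "x (Suc n) 0 \<le> x n 0 ^ (d + 1) * (1 + 2 * b) ^ ((d + 1) choose 2)" if "n \<ge> m" for n
    using gasket_step_0_bounds[OF ratios_n[OF that]] a nonneg by (simp_all add: x_Suc)
  have x_pos: "0 < x n 0" if "n \<ge> m" for n
    using that
  proof (induction n rule: dec_induct)
    case (step n)
    have "0 < x n 0 ^ (d + 1) * (1 + 2 * a) ^ ((d + 1) choose 2)" using step.IH a by simp
    then show ?case using bounds(1)[of n] step.hyps by linarith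
  qed (rule pos)
  have ln_prod: "ln (x n 0 ^ (d + 1) * (1 + 2 * c) ^ ((d + 1) choose 2)) = D * ln (x n 0) + C * ln (1 + 2 * c)"
    if "n \<ge> m" "0 \<le> c" for n c
    using x_pos[OF that(1)] that(2)
    by (subst ln_mult) (auto simp: ln_realpow C_def D_def simp del: power_Suc)
  have ln_ge: "D * ln (x n 0) + C * ln (1 + 2 * a) \<le> ln (x (Suc n) 0)" if "n \<ge> m" for n
    unfolding ln_prod[OF that a(1), symmetric] using bounds(1)[OF that] x_pos that a
    by (intro ln_mono) auto
  have ln_le: "ln (x (Suc n) 0) \<le> D * ln (x n 0) + C * ln (1 + 2 * b)" if "n \<ge> m" for n
  proof -
    have "0 \<le> b" using a by simp
    show ?thesis unfolding ln_prod[OF that \<open>0 \<le> b\<close>, symmetric] using bounds(2)[OF that] x_pos that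
      by (intro ln_mono) auto
  qed
  \<comment> \<open>The correction \<open>D / 2\<close> is the solution \<open>t\<close> of
    \<open>D * t = C + t\<close>. It absorbs the term \<open>C * ln (1 + 2 * c)\<close> gained at
    each level, so \<open>u a\<close> increases, \<open>u b\<close> decreases, and their gap is a
    constant over \<open>D ^ n\<close>.\<close>
  define u where "u c n = (ln (x n 0) + ln (1 + 2 * c) * D / 2) / D ^ n" for c n
  have u_Suc: "u c n = (D * ln (x n 0) + C * ln (1 + 2 * c) + ln (1 + 2 * c) * D / 2) / D ^ Suc n" for c n
  proof -
    have "D * ln (x n 0) + C * ln (1 + 2 * c) + ln (1 + 2 * c) * D / 2 =
        D * ln (x n 0) + ln (1 + 2 * c) * (C + D / 2)" by (simp add: algebra_simps)
    also have "\<dots> = D * (ln (x n 0) + ln (1 + 2 * c) * D / 2)" unfolding C by (simp add: algebra_simps)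
    finally show ?thesis using D by (simp add: u_def)
  qed
  have inc: "u a n \<le> u a (Suc n)" if "n \<ge> m" for n
    unfolding u_Suc[of a n] unfolding u_def using ln_ge[OF that] D by (intro divide_right_mono) auto
  have dec: "u b (Suc n) \<le> u b n" if "n \<ge> m" for n
    unfolding u_Suc[of b n] unfolding u_def using ln_le[OF that] D by (intro divide_right_mono) auto
  have pow0: "(\<lambda>n. K / D ^ n) \<longlonglongrightarrow> 0" for K
    using LIMSEQ_divide_realpow_zero[of D K] D by simp
  have "\<exists>l. ((\<forall>n. u a (n + m) \<le> l) \<and> (\<lambda>n. u a (n + m)) \<longlonglongrightarrow> l) \<and>
      ((\<forall>n. l \<le> u b (n + m)) \<and> (\<lambda>n. u b (n + m)) \<longlonglongrightarrow> l)"
  proof (rule nested_sequence_unique)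
    have "ln (1 + 2 * a) \<le> ln (1 + 2 * b)" using a by simp
    then show "\<forall>n. u a (n + m) \<le> u b (n + m)"
      unfolding u_def using D by (intro allI divide_right_mono add_left_mono mult_right_mono) auto
    have "(\<lambda>n. u a n - u b n) = (\<lambda>n. ((ln (1 + 2 * a) - ln (1 + 2 * b)) * D / 2) / D ^ n)"
      by (auto simp: u_def algebra_simps simp flip: diff_divide_distrib)
    then have "(\<lambda>n. u a n - u b n) \<longlonglongrightarrow> 0" by (simp only: pow0)
    then show "(\<lambda>n. u a (n + m) - u b (n + m)) \<longlonglongrightarrow> 0" by (rule LIMSEQ_ignore_initial_segment)
  qed (use inc dec in auto)
  then obtain l where l: "u a m \<le> l" "l \<le> u b m" and "(\<lambda>n. u a (n + m)) \<longlonglongrightarrow> l"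
    by (metis add_0)
  then have ua: "u a \<longlonglongrightarrow> l" by (simp add: LIMSEQ_offset)
  have y: "(\<lambda>n. ln (x n 0) / D ^ n) \<longlonglongrightarrow> l"
  proof -
    have "(\<lambda>n. u a n - (ln (1 + 2 * a) * D / 2) / D ^ n) \<longlonglongrightarrow> l - 0"
      by (intro tendsto_diff ua pow0)
    then show ?thesis by (simp add: u_def add_divide_distrib)
  qed
  \<comment> \<open>There are \<open>2 ^ (d + 1)\<close> boundary sets, each with count at most
    \<open>x n 0\<close> times a power of \<open>b\<close>; the base \<open>1 + b\<close> covers the
    case \<open>b < 1\<close>. A constant factor does not affect the limit.\<close>
  define K where "K = 2 ^ (d + 1) * (1 + b) ^ (d + 1)"
  have N: "x n 0 \<le> real (N_DM (SG d n))" "real (N_DM (SG d n)) \<le> K * x n 0" if "n \<ge> m" for n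
  proof -
    have N_eq: "real (N_DM (SG d n)) = (\<Sum>S\<in>Pow {1..d+1}. x n (card S))"
      unfolding N_DM_eq_sum_cnt of_nat_sum by (intro sum.cong refl) (simp add: cnt_eq_boundary_count x_def)
    have "(\<Sum>S\<in>{{} :: nat set}. x n (card S)) \<le> (\<Sum>S\<in>Pow {1..d+1}. x n (card S))"
      by (rule sum_mono2) (auto simp: nonneg)
    then show "x n 0 \<le> real (N_DM (SG d n))" by (simp add: N_eq)
    have "(\<Sum>S\<in>Pow {1..d+1}. x n (card S)) \<le> (\<Sum>S\<in>Pow {1..d+1}. x n 0 * (1 + b) ^ (d + 1))"
    proof (rule sum_mono)
      fix S assume "S \<in> Pow {1..d+1}"
      then have card: "card S \<le> d + 1" using card_mono[of "{1..d+1}" S] by simp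
      have "x n (card S) \<le> x n 0 * b ^ card S"
        using ratios_between_power[OF ratios_n[OF that] _ _ card] a by simp
      also have "b ^ card S \<le> (1 + b) ^ card S" using a by (intro power_mono) auto
      also have "(1 + b) ^ card S \<le> (1 + b) ^ (d + 1)" using a card by (intro power_increasing) auto
      finally show "x n (card S) \<le> x n 0 * (1 + b) ^ (d + 1)" using nonneg by (simp add: mult_left_mono)
    qed
    also have "\<dots> = K * x n 0" by (simp add: card_Pow K_def)
    finally show "real (N_DM (SG d n)) \<le> K * x n 0" unfolding N_eq .
  qed
  have K: "0 < K" using a by (simp add: K_def)
  have "(\<lambda>n. ln (real (N_DM (SG d n))) / D ^ n) \<longlonglongrightarrow> l"
  proof (rule tendsto_sandwich)
    show "eventually (\<lambda>n. ln (x n 0) / D ^ n \<le> ln (real (N_DM (SG d n))) / D ^ n) sequentially"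
      using eventually_ge_at_top[of m]
    proof eventually_elim
      case (elim n)
      then show ?case using N(1)[OF elim] x_pos[OF elim] D by (intro divide_right_mono ln_mono) auto
    qed
    show "eventually (\<lambda>n. ln (real (N_DM (SG d n))) / D ^ n \<le> ln (x n 0) / D ^ n + ln K / D ^ n) sequentially"
      using eventually_ge_at_top[of m]
    proof eventually_elim
      case (elim n)
      have "ln (real (N_DM (SG d n))) \<le> ln (K * x n 0)"
        using N[OF elim] x_pos[OF elim] K by (intro ln_mono) auto
      also have "\<dots> = ln (x n 0) + ln K" using x_pos[OF elim] K by (simp add: ln_mult)
      finally show ?case using D by (simp add: divide_right_mono flip: add_divide_distrib)
    qed
    show "(\<lambda>n. ln (x n 0) / D ^ n + ln K / D ^ n) \<longlonglongrightarrow> l"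
      using tendsto_add[OF y pow0[of "ln K"]] by simp
  qed (rule y)
  moreover have "(\<lambda>n. D / 2 * (1 + 1 / D ^ n)) \<longlonglongrightarrow> D / 2 * (1 + 0)"
    by (intro tendsto_intros pow0)
  ultimately have "(\<lambda>n. (ln (real (N_DM (SG d n))) / D ^ n) / (D / 2 * (1 + 1 / D ^ n))) \<longlonglongrightarrow> l / (D / 2 * (1 + 0))"
    using D by (intro tendsto_divide) auto
  moreover have "(ln (real (N_DM (SG d n))) / D ^ n) / (D / 2 * (1 + 1 / D ^ n)) =
      ln (real (N_DM (SG d n))) / real (card (verts (SG d n)))" for n
  proof -
    have "real (card (verts (SG d n))) = D ^ n * (D / 2 * (1 + 1 / D ^ n))"
      using D by (simp add: card_verts_SG D_def field_simps)
    then show ?thesis by (simp only: divide_divide_eq_left)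
  qed
  ultimately have lim: "(\<lambda>n. ln (real (N_DM (SG d n))) / real (card (verts (SG d n)))) \<longlonglongrightarrow> 2 / D * l"
    by (simp add: mult.commute)
  have eq: "2 / D * u c m = (2 / D * ln (x m 0) + ln (1 + 2 * c)) / D ^ m" for c
    using D by (simp add: u_def field_simps)
  have le: "2 / D * u a m \<le> 2 / D * l" "2 / D * l \<le> 2 / D * u b m"
    using l D by (auto intro!: mult_left_mono divide_right_mono)
  show ?thesis using lim le unfolding eq by blast
qed

subsection \<open>Boundary counts of the first levels\<close>

text \<open>The generating polynomial carries the binomial coefficients of 5. Writing them out in
  the second premise lets the claimed counts be taken from the goal, so that premise becomes a
  ground identity of numerals, checked by rewriting.\<close>

lemma map_gasket_step:
  fixes f :: "nat \<Rightarrow> nat"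
  assumes f: "map f [0..<6] = [f0, f1, f2, f3, f4, f5]"
    and g: "five_sum [:f0, f1:] [:f1, f2:] [:f2, f3:] [:f3, f4:] [:f4, f5:] =
      [:g0, 5 * g1, 10 * g2, 10 * g3, 5 * g4, g5:]"
  shows "map (gasket_step 4 f) [0..<6] = [g0, g1, g2, g3, g4, g5]"
proof -
  have upt: "[0..<6] = [0, 1, 2, 3, 4, 5]" by (simp add: upt_rec)
  have "junction_sum {1..4+1::nat} (\<lambda>l j. [:f j, f (Suc j):]) = [:g0, 5 * g1, 10 * g2, 10 * g3, 5 * g4, g5:]"
    unfolding junction_sum_5 g[symmetric] using f by (simp add: upt eval_nat_numeral)
  then have "coeff [:g0, 5 * g1, 10 * g2, 10 * g3, 5 * g4, g5:] k = (5 choose k) * gasket_step 4 f k"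
    if "k \<le> 5" for k
    using coeff_junction_sum_linear[of k 4 f] that by simp
  from this[of 0] this[of 1] this[of 2] this[of 3] this[of 4] this[of 5] show ?thesis
    by (simp add: upt eval_nat_numeral)
qed

lemma map_boundary_count_Suc:
  "map (boundary_count 4 (Suc n)) [0..<6] = map (gasket_step 4 (boundary_count 4 n)) [0..<6]"
  by (rule map_cong) (simp_all add: boundary_count_Suc)

text \<open>
  With \<open>let_weak_cong\<close> the simplifier evaluates each shared subterm of \<open>five_sum\<close> once, before
  \<open>Let_def\<close> substitutes it.
\<close>

lemmas five_sum_eval = five_sum_def Let_def triple_sum.simps
  add_pCons mult_pCons_left smult_pCons smult_0_right mult_zero_left mult_zero_right
  add_0 add_0_right pCons_0_0 mult_1_left mult_1_right one_add_one one_plus_numeral numeral_plus_one arith_simps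

lemma boundary_count_0: "map (boundary_count 4 0) [0..<6] = [1, 0, 1, 0, 3, 0]"
  by (simp add: upt_rec boundary_count_def cnt_0 eval_nat_numeral)

lemma boundary_count_1:
  "map (boundary_count 4 1) [0..<6] = [2460, 3168, 3990, 4852, 5683, 6204]"
  unfolding One_nat_def map_boundary_count_Suc
  by (rule map_gasket_step[OF boundary_count_0], simp only: five_sum_eval cong: let_weak_cong)

lemma boundary_count_2:
  "map (boundary_count 4 2) [0..<6] = [
    27951923701499685610752,
    34593006758221606500864,
    42806033106111666338688,
    52961649817161203920896,
    65517552720775495239744,
    81038847105336439783296]"
  unfolding Suc_1[symmetric] map_boundary_count_Suc
  by (rule map_gasket_step[OF boundary_count_1], simp only: five_sum_eval cong: let_weak_cong)

lemma boundary_count_3: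
  "map (boundary_count 4 3) [0..<6] = [
    4381290355170456323411540736988672115345849305231157688784584133989733549574862862597653855841117080778234763673600000,
    5421171051365193865850489195042537853957539440137221258563307363400020793227130776886205652720845252643085532476211200,
    6707863007062807099324066192733985836022314486972348621871700444888559752542266827448974911793258270054389225042739200,
    8299945820876743758650694535870540947505027485297614508048797620381155945150834903931880959781035589630732316243394560,
    10269902708109942898788902378804065880888285035823347487497742053100637821713072742570075748315880411933501818509721600,
    12707420464374251619241579496759934320431320201435719487972101690719643208184434477945221384227815630005307537201561600]"
  unfolding numeral_3_eq_3 Suc_1[unfolded One_nat_def] map_boundary_count_Suc
  by (rule map_gasket_step[OF boundary_count_2], simp only: five_sum_eval cong: let_weak_cong)

text \<open>The counts of level three divided by \<open>10^102\<close> and rounded down.\<close>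

definition leading_digits_3 :: "nat list" where
  "leading_digits_3 = [
    4381290355170456,
    5421171051365193,
    6707863007062807,
    8299945820876743,
    10269902708109942,
    12707420464374251]"

text \<open>An exact step on truncated inputs: numbers of about 84 digits replace the true counts of
  about 594 digits.\<close>

lemma gasket_step_leading_digits_3:
  "map (gasket_step 4 (\<lambda>k. leading_digits_3 ! k)) [0..<6] = [
    414164357481597732410601632458040823507127683605446589990044279887144671130023996406,
    512464510564768815052092808385558114022617445260267266564962793458187418201935551809,
    634095787926552440298841347559766450892968181836690654987328150659304950829415484406,
    784595732928081526722753921682430488988522725800652938735788272356272900729817956012,
    970816201353252822641883440254740134237928652959565685559682764990508797764911601880,
    1201235307886068424930499395963705739521266250013130328163467347417110429058804945033]"
  by (rule map_gasket_step[where f = "\<lambda>k. leading_digits_3 ! k"], simp add: leading_digits_3_def upt_rec,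
      simp only: five_sum_eval cong: let_weak_cong)

subsection \<open>Numerical logarithms\<close>

lemma ln_2_bounds: "693147180559945 / 10 ^ 15 \<le> ln (2 :: real)" "ln (2 :: real) \<le> 693147180559946 / 10 ^ 15"
  using ln_approx_bounds[of 2 16]
  by (simp_all add: lessThan_nat_numeral lessThan_Suc power_divide)

text \<open>Splitting off powers of two brings the argument near 1, where the series behind
  \<open>ln_approx_bounds\<close> converges faster: 11 terms for \<open>3 / 2\<close> and later 8
  for \<open>5 / 4\<close>, against 16 for \<open>2\<close>.\<close>

lemma ln_3_bounds: "1098612288668109 / 10 ^ 15 \<le> ln (3 :: real)" "ln (3 :: real) \<le> 1098612288668111 / 10 ^ 15"
proof -
  have "ln (3 :: real) = ln 2 + ln (3 / 2)" using ln_mult[of 2 "3 / 2 :: real"] by simp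
  moreover have "405465108108164 / 10 ^ 15 \<le> ln (3 / 2 :: real)" "ln (3 / 2 :: real) \<le> 405465108108165 / 10 ^ 15"
    using ln_approx_bounds[of "3 / 2" 11] by (simp_all add: lessThan_nat_numeral lessThan_Suc power_divide)
  ultimately show "1098612288668109 / 10 ^ 15 \<le> ln (3 :: real)" "ln (3 :: real) \<le> 1098612288668111 / 10 ^ 15"
    using ln_2_bounds by simp_all
qed

lemma ln_5_bounds: "1609437912434099 / 10 ^ 15 \<le> ln (5 :: real)" "ln (5 :: real) \<le> 1609437912434102 / 10 ^ 15"
proof -
  have "ln (5 :: real) = 2 * ln 2 + ln (5 / 4)"
    using ln_mult[of 2 "2 :: real"] ln_mult[of 4 "5 / 4 :: real"] by simp
  moreover have "223143551314209 / 10 ^ 15 \<le> ln (5 / 4 :: real)" "ln (5 / 4 :: real) \<le> 223143551314210 / 10 ^ 15"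
    using ln_approx_bounds[of "5 / 4" 8] by (simp_all add: lessThan_nat_numeral lessThan_Suc power_divide)
  ultimately show "1609437912434099 / 10 ^ 15 \<le> ln (5 :: real)" "ln (5 :: real) \<le> 1609437912434102 / 10 ^ 15"
    using ln_2_bounds by simp_all
qed


text \<open>
  \<open>2^384 * 3^26 * 5^60\<close> is a product of small primes close to the number whose logarithm is needed
  in \<open>ln_boundary_count_4_bounds\<close>; the two arguments below bound the quotient.
\<close>

lemma ln_residue_bounds:
  "127777733 / 10 ^ 12 \<le> ln (10001277858971 / 10 ^ 13 :: real)"
  "ln (10001277859260 / 10 ^ 13 :: real) \<le> 127777763 / 10 ^ 12"
  using ln_approx_bounds[of "10001277858971 / 10 ^ 13" 1] ln_approx_bounds[of "10001277859260 / 10 ^ 13" 1]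
  by (simp_all add: power_divide)

subsection \<open>Bounds at level four\<close>

text \<open>Hidden behind a constant so that the simplifier does not expand the numeral.\<close>

definition scale_4 :: real where
  "scale_4 = 10 ^ 510"

lemma scale_4_pos: "0 < scale_4"
  unfolding scale_4_def by (rule zero_less_power) simp

text \<open>Rounding down at level three loses less than \<open>10 ^ 102\<close> per count, a
  relative error of at most \<open>1 / 10 ^ 15\<close> since the kept digits exceed
  \<open>10 ^ 15\<close>. The step raises both the scale and the error factor to the fifth power,
  giving \<open>10 ^ 510\<close> and less than \<open>1 + 1 / 10 ^ 14\<close>.\<close>

lemma boundary_count_4_bounds:
  assumes "k \<le> 5"
  shows "scale_4 * real (gasket_step 4 (\<lambda>k. leading_digits_3 ! k) k) \<le> real (boundary_count 4 4 k)"
    and "real (boundary_count 4 4 k) \<le>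
      scale_4 * ((1 + 1 / 10 ^ 14) * real (gasket_step 4 (\<lambda>k. leading_digits_3 ! k) k))"
proof -
  let ?F = "\<lambda>k. real (leading_digits_3 ! k)" and ?x = "\<lambda>k. real (boundary_count 4 3 k)"
  have upt: "[0..<6] = [0, 1, 2, 3, 4, 5]" by (simp add: upt_rec)
  have ex: "j = 0 \<or> j = 1 \<or> j = 2 \<or> j = 3 \<or> j = 4 \<or> j = 5" if "j \<le> 4 + 1" for j :: nat
    using that by linarith
  have x3: "10 ^ 102 * leading_digits_3 ! j \<le> boundary_count 4 3 j \<and>
      boundary_count 4 3 j \<le> 10 ^ 102 * (leading_digits_3 ! j + 1)" if "j \<le> 4 + 1" for j
    using boundary_count_3 ex[OF that] by (auto simp: upt leading_digits_3_def)
  have digits: "10 ^ 15 \<le> leading_digits_3 ! j" if "j \<le> 4 + 1" for j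
    using ex[OF that] by (auto simp: leading_digits_3_def)
  have lower: "10 ^ 102 * ?F j \<le> ?x j" if "j \<le> 4 + 1" for j
  proof -
    have "real (10 ^ 102 * leading_digits_3 ! j) \<le> ?x j" using x3[OF that] by (subst of_nat_le_iff) blast
    then show ?thesis by simp
  qed
  have upper: "?x j \<le> (10 ^ 102 * (1 + 1 / 10 ^ 15)) * ?F j" if "j \<le> 4 + 1" for j
  proof -
    have "?x j \<le> real (10 ^ 102 * (leading_digits_3 ! j + 1))" using x3[OF that] by (subst of_nat_le_iff) blast
    also have "\<dots> = 10 ^ 102 * (?F j + 1)" by simp
    also have "\<dots> \<le> 10 ^ 102 * ((1 + 1 / 10 ^ 15) * ?F j)"
    proof (rule mult_left_mono)
      have "real (10 ^ 15) \<le> ?F j" using digits[OF that] by (subst of_nat_le_iff)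
      then show "?F j + 1 \<le> (1 + 1 / 10 ^ 15) * ?F j" by simp
    qed simp
    finally show ?thesis by (simp only: mult.assoc)
  qed
  have step: "real (boundary_count 4 4 k) = gasket_step 4 ?x k"
    using boundary_count_Suc[of k 4 3] assms by (simp add: of_nat_gasket_step)
  have pow: "(10 ^ 102) ^ (4 + 1) = scale_4"
    unfolding scale_4_def power_mult[symmetric] by (rule arg_cong[where f = "(^) 10"]) simp
  \<comment> \<open>Stated for variables so that the powers of numerals are rearranged without being
    evaluated.\<close>
  have pow_mult: "(s * c) ^ (4 + 1) * g = s ^ (4 + 1) * (c ^ 5 * g)" for s c g :: real
    by (simp add: power_mult_distrib)
  have "(10 ^ 102) ^ (4 + 1) * gasket_step 4 ?F k \<le> gasket_step 4 ?x k"
    by (rule gasket_step_scale_le) (use assms lower in auto)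
  then show "scale_4 * real (gasket_step 4 (\<lambda>k. leading_digits_3 ! k) k) \<le> real (boundary_count 4 4 k)"
    unfolding step pow of_nat_gasket_step .
  have "gasket_step 4 ?x k \<le> (10 ^ 102 * (1 + 1 / 10 ^ 15)) ^ (4 + 1) * gasket_step 4 ?F k"
    by (rule gasket_step_le_scale) (use assms upper in auto)
  also have "\<dots> = scale_4 * ((1 + 1 / 10 ^ 15) ^ 5 * real (gasket_step 4 (\<lambda>k. leading_digits_3 ! k) k))"
    unfolding pow_mult pow of_nat_gasket_step ..
  also have "\<dots> \<le> scale_4 * ((1 + 1 / 10 ^ 14) * real (gasket_step 4 (\<lambda>k. leading_digits_3 ! k) k))"
    by (intro mult_left_mono mult_right_mono less_imp_le[OF scale_4_pos]) (simp_all add: power_divide)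
  finally show "real (boundary_count 4 4 k) \<le>
      scale_4 * ((1 + 1 / 10 ^ 14) * real (gasket_step 4 (\<lambda>k. leading_digits_3 ! k) k))"
    unfolding step .
qed

text \<open>An interval of width \<open>1 / 10 ^ 11\<close> leaves an uncertainty below
  \<open>1 / 10 ^ 14\<close> in the growth constant, after division by \<open>5 ^ 4\<close>.\<close>

lemma ratios_between_boundary_count_4:
  "ratios_between 4 (123734575732 / 10 ^ 11) (123734575733 / 10 ^ 11) (\<lambda>k. real (boundary_count 4 4 k))"
  unfolding ratios_between_def
proof (intro allI impI)
  fix k :: nat assume k: "k \<le> 4"
  let ?G = "\<lambda>k. gasket_step 4 (\<lambda>k. leading_digits_3 ! k) k"
  let ?x = "\<lambda>k. real (boundary_count 4 4 k)" and ?s = scale_4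
  let ?a = "123734575732 / 10 ^ 11 :: real" and ?b = "123734575733 / 10 ^ 11 :: real"
  have upt: "[0..<6] = [0, 1, 2, 3, 4, 5]" by (simp add: upt_rec)
  define k' where "k' = Suc k"
  have "k = 0 \<and> k' = 1 \<or> k = 1 \<and> k' = 2 \<or> k = 2 \<and> k' = 3 \<or> k = 3 \<and> k' = 4 \<or> k = 4 \<and> k' = 5"
    using k unfolding k'_def by linarith
  \<comment> \<open>Both comparisons are multiplied by \<open>10 ^ 25 = 10 ^ 11 * 10 ^ 14\<close>,
    clearing the denominators of the ratio and of the truncation factor
    \<open>1 + 1 / 10 ^ 14\<close>, so that they are decided on natural numerals.\<close>
  then have "123734575732 * (10 ^ 14 + 1) * ?G k \<le> 10 ^ 25 * ?G k' \<and>
      10 ^ 11 * (10 ^ 14 + 1) * ?G k' \<le> 123734575733 * 10 ^ 14 * ?G k"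
    using gasket_step_leading_digits_3 by (auto simp: upt)
  then have "real (123734575732 * (10 ^ 14 + 1) * ?G k) \<le> real (10 ^ 25 * ?G k')"
      "real (10 ^ 11 * (10 ^ 14 + 1) * ?G k') \<le> real (123734575733 * 10 ^ 14 * ?G k)"
    unfolding of_nat_le_iff by blast+
  then have G: "?a * ((1 + 1 / 10 ^ 14) * real (?G k)) \<le> real (?G (Suc k))"
      "(1 + 1 / 10 ^ 14) * real (?G (Suc k)) \<le> ?b * real (?G k)"
    by (simp_all add: k'_def)
  have "?a * ?x k \<le> ?a * (?s * ((1 + 1 / 10 ^ 14) * real (?G k)))"
    using boundary_count_4_bounds(2)[of k] k by (intro mult_left_mono) auto
  also have "\<dots> = ?s * (?a * ((1 + 1 / 10 ^ 14) * real (?G k)))" by (simp only: mult.left_commute)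
  also have "\<dots> \<le> ?s * real (?G (Suc k))" using G(1) by (rule mult_left_mono) (simp add: less_imp_le scale_4_pos)
  also have "\<dots> \<le> ?x (Suc k)" using boundary_count_4_bounds(1)[of "Suc k"] k by simp
  finally have 1: "?a * ?x k \<le> ?x (Suc k)" .
  have "?x (Suc k) \<le> ?s * ((1 + 1 / 10 ^ 14) * real (?G (Suc k)))"
    using boundary_count_4_bounds(2)[of "Suc k"] k by simp
  also have "\<dots> \<le> ?s * (?b * real (?G k))" using G(2) by (rule mult_left_mono) (simp add: less_imp_le scale_4_pos)
  also have "\<dots> = ?b * (?s * real (?G k))" by (simp only: mult.left_commute)
  also have "\<dots> \<le> ?b * ?x k"
    using boundary_count_4_bounds(1)[of k] k by (intro mult_left_mono) auto
  finally show "?a * ?x k \<le> ?x (Suc k) \<and> ?x (Suc k) \<le> ?b * ?x k" using 1 by blast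
qed

text \<open>The bounds of \<open>gasket_growth_constant\<close> at \<open>d = m = 4\<close>,
  multiplied by \<open>5 ^ 5 = 3125\<close>. Comparing \<open>G ^ 2 * (1 + 2 * c) ^ 5\<close> with a
  product of small primes is exact rational arithmetic; only logarithms of 2, 3, 5 and of a number
  close to 1 are approximated.\<close>

lemma ln_boundary_count_4_bounds:
  defines "x \<equiv> real (boundary_count 4 4 0)"
  shows "0 < x"
    and "3125 * 876779402949 / 10 ^ 12 \<le> 2 * ln x + 5 * ln (1 + 2 * (123734575732 / 10 ^ 11))"
    and "2 * ln x + 5 * ln (1 + 2 * (123734575733 / 10 ^ 11)) < 3125 * 876779402950 / 10 ^ 12"
proof -
  define G :: real where "G = 414164357481597732410601632458040823507127683605446589990044279887144671130023996406"
  have upt: "[0..<6] = [0, 1, 2, 3, 4, 5]" by (simp add: upt_rec)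
  have G: "real (gasket_step 4 (\<lambda>k. leading_digits_3 ! k) 0) = G"
    using gasket_step_leading_digits_3 by (simp add: upt G_def)
  have G_pos: "0 < G" by (simp add: G_def)
  have x: "scale_4 * G \<le> x" "x \<le> scale_4 * ((1 + 1 / 10 ^ 14) * G)"
    using boundary_count_4_bounds[of 0] unfolding x_def G by simp_all
  have "0 < scale_4 * G" using G_pos scale_4_pos by simp
  then show "0 < x" using x(1) by (rule less_le_trans)
  have ln10: "ln (10 :: real) = ln 2 + ln 5" using ln_mult[of 2 "5 :: real"] by simp
  have ln_prod: "ln (p ^ 384 * r ^ 26 * s ^ 60 * q) = 384 * ln p + 26 * ln r + 60 * ln s + ln q"
    if "0 < p" "0 < r" "0 < s" "0 < q" for p q r s :: real
    using that by (simp add: ln_mult ln_realpow)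
  have ln_pow: "ln (2 ^ 384 * 3 ^ 26 * 5 ^ 60 * q) = 384 * ln 2 + 26 * ln 3 + 60 * ln 5 + ln q" if "0 < q" for q :: real
    by (rule ln_prod) (use that in simp_all)
  have ln_sq: "ln (y ^ 2 * w ^ 5) = 2 * ln y + 5 * ln w" if "0 < y" "0 < w" for y w :: real
    using that by (simp add: ln_mult ln_realpow)
  have ln_scaled: "ln (scale_4 * y) = 510 * (ln 2 + ln 5) + ln y" if "0 < y" for y :: real
  proof -
    have "ln scale_4 = 510 * (ln 2 + ln 5)" unfolding scale_4_def by (simp only: ln_realpow ln10 of_nat_numeral)
    then show ?thesis using that scale_4_pos by (simp add: ln_mult)
  qed
  have "510 * (ln 2 + ln 5) + ln G \<le> ln x"
    unfolding ln_scaled[OF G_pos, symmetric] using x(1) \<open>0 < scale_4 * G\<close> by (intro ln_mono) auto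
  moreover have "384 * ln 2 + 26 * ln 3 + 60 * ln 5 + ln (10001277858971 / 10 ^ 13) \<le>
      2 * ln G + 5 * ln (1 + 2 * (123734575732 / 10 ^ 11))"
  proof -
    have "2 ^ 384 * 3 ^ 26 * 5 ^ 60 * (10001277858971 / 10 ^ 13) \<le> G ^ 2 * (1 + 2 * (123734575732 / 10 ^ 11)) ^ 5"
      unfolding G_def by (simp add: power_divide)
    then have "ln (2 ^ 384 * 3 ^ 26 * 5 ^ 60 * (10001277858971 / 10 ^ 13)) \<le>
        ln (G ^ 2 * (1 + 2 * (123734575732 / 10 ^ 11)) ^ 5)"
      by (rule ln_mono) simp
    moreover have "ln (G ^ 2 * (1 + 2 * (123734575732 / 10 ^ 11)) ^ 5) =
        2 * ln G + 5 * ln (1 + 2 * (123734575732 / 10 ^ 11))"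
      by (rule ln_sq[OF G_pos]) simp
    moreover have "ln (2 ^ 384 * 3 ^ 26 * 5 ^ 60 * (10001277858971 / 10 ^ 13)) =
        384 * ln 2 + 26 * ln 3 + 60 * ln 5 + ln (10001277858971 / 10 ^ 13 :: real)"
      by (rule ln_pow) simp
    ultimately show ?thesis by (simp only:)
  qed
  ultimately show "3125 * 876779402949 / 10 ^ 12 \<le> 2 * ln x + 5 * ln (1 + 2 * (123734575732 / 10 ^ 11))"
    using ln_2_bounds(1) ln_3_bounds(1) ln_5_bounds(1) ln_residue_bounds(1) by simp
  have "0 < (1 + 1 / 10 ^ 14) * G" using G_pos by simp
  then have "ln x \<le> 510 * (ln 2 + ln 5) + ln ((1 + 1 / 10 ^ 14) * G)"
    unfolding ln_scaled[OF \<open>0 < (1 + 1 / 10 ^ 14) * G\<close>, symmetric] using x(2) \<open>0 < x\<close> by (intro ln_mono) auto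
  moreover have "2 * ln ((1 + 1 / 10 ^ 14) * G) + 5 * ln (1 + 2 * (123734575733 / 10 ^ 11)) \<le>
      384 * ln 2 + 26 * ln 3 + 60 * ln 5 + ln (10001277859260 / 10 ^ 13)"
  proof -
    have "((1 + 1 / 10 ^ 14) * G) ^ 2 * (1 + 2 * (123734575733 / 10 ^ 11)) ^ 5 \<le>
        2 ^ 384 * 3 ^ 26 * 5 ^ 60 * (10001277859260 / 10 ^ 13)"
      unfolding G_def by (simp add: power_divide)
    then have "ln (((1 + 1 / 10 ^ 14) * G) ^ 2 * (1 + 2 * (123734575733 / 10 ^ 11)) ^ 5) \<le>
        ln (2 ^ 384 * 3 ^ 26 * 5 ^ 60 * (10001277859260 / 10 ^ 13))"
      by (rule ln_mono) (use G_pos in simp)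
    moreover have "ln (((1 + 1 / 10 ^ 14) * G) ^ 2 * (1 + 2 * (123734575733 / 10 ^ 11)) ^ 5) =
        2 * ln ((1 + 1 / 10 ^ 14) * G) + 5 * ln (1 + 2 * (123734575733 / 10 ^ 11))"
      by (rule ln_sq[OF \<open>0 < (1 + 1 / 10 ^ 14) * G\<close>]) simp
    moreover have "ln (2 ^ 384 * 3 ^ 26 * 5 ^ 60 * (10001277859260 / 10 ^ 13)) =
        384 * ln 2 + 26 * ln 3 + 60 * ln 5 + ln (10001277859260 / 10 ^ 13 :: real)"
      by (rule ln_pow) simp
    ultimately show ?thesis by (simp only:)
  qed
  \<comment> \<open>The tightest comparison: it holds with a margin of about
    \<open>6 / 10 ^ 10\<close>. The total coefficients of \<open>ln 2\<close>, \<open>ln 3\<close>,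
    \<open>ln 5\<close> are 1404, 26, 1080, so the widths of their enclosures add up to less than
    \<open>5 / 10 ^ 12\<close>.\<close>
  ultimately show "2 * ln x + 5 * ln (1 + 2 * (123734575733 / 10 ^ 11)) < 3125 * 876779402950 / 10 ^ 12"
    using ln_2_bounds(2) ln_3_bounds(2) ln_5_bounds(2) ln_residue_bounds(2) by simp
qed

theorem propositionV2:
  shows "\<exists>z :: real.
    (\<lambda>n. ln (real (N_DM (SG 4 n))) / real (card (verts (SG 4 n)))) \<longlonglongrightarrow> z \<and>
    0.876779402949 \<le> z \<and> z < 0.876779402950"
proof -
  have "\<exists>z. (\<lambda>n. ln (real (N_DM (SG 4 n))) / real (card (verts (SG 4 n)))) \<longlonglongrightarrow> z \<and>
    (2 / real (4 + 1) * ln (real (boundary_count 4 4 0)) + ln (1 + 2 * (123734575732 / 10 ^ 11))) / real (4 + 1) ^ 4 \<le> z \<and>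
    z \<le> (2 / real (4 + 1) * ln (real (boundary_count 4 4 0)) + ln (1 + 2 * (123734575733 / 10 ^ 11))) / real (4 + 1) ^ 4"
    by (rule gasket_growth_constant[OF _ _ _ ratios_between_boundary_count_4])
      (simp_all add: ln_boundary_count_4_bounds(1)[simplified])
  then obtain z where "(\<lambda>n. ln (real (N_DM (SG 4 n))) / real (card (verts (SG 4 n)))) \<longlonglongrightarrow> z"
    and z: "(2 / real (4 + 1) * ln (real (boundary_count 4 4 0)) + ln (1 + 2 * (123734575732 / 10 ^ 11))) / real (4 + 1) ^ 4 \<le> z"
      "z \<le> (2 / real (4 + 1) * ln (real (boundary_count 4 4 0)) + ln (1 + 2 * (123734575733 / 10 ^ 11))) / real (4 + 1) ^ 4"
    by blast
  moreover have "0.876779402949 \<le> z" using z(1) ln_boundary_count_4_bounds(2) by (simp add: field_simps)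
  moreover have "z < 0.876779402950" using z(2) ln_boundary_count_4_bounds(3) by (simp add: field_simps)
  ultimately show ?thesis by blast
qed

end
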